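(* The satisfiability problem for $\mathsf{LCPDL}$ over order-2 nested words (given an $\mathsf{LCPDL}$ sentence $\phi$, does some order-2 nested word $\mathcal N$ satisfy $\mathcal N\models\phi$?) and the model checking problem for $\mathsf{LCPDL}$ against 2-CPDS (given an $\mathsf{LCPDL}$ sentence $\phi$ and a 2-CPDS $\mathcal H$, does every order-2 nested word in $\mathcal L(\mathcal H)$ satisfy $\phi$?) are both undecidable. This holds even when restricted to order-2 nested words (resp. 2-CPDS) without collapse operations and whose order-2 stacks have height bounded by a fixed constant.
   Context: Order-2 stacks over a finite set $S$ of stack symbols are $[[u_1]\cdots[u_n]]$ with $u_i$ words over $S\times\{0,\dots,i-1\}$ (second components are collapse links); the initial stack is $[[\,]]$. The operations $\mathsf{Op}(S)$ are: $\uparrow_2$ (duplicate the top order-1 stack), $\downarrow_2$ (remove the top order-1 stack; undefined if only one), $\uparrow_1^s$ for $s\in S$ (append $(s,n-1)$ to the top stack $u_n$), $\downarrow_1$ (remove the last letter of the top stack; undefined if empty), $\Downarrow$ (collapse: if $u_n=u_n'(s,i)$, map to $[[u_1]\cdots[u_i]]$), $\mathsf{top}(s)$ (test that the last letter of $u_n$ has symbol $s$) and $\mathsf{top}(\bot)$ (test that $u_n$ is empty). A 2-CPDS is $\mathcal H=(Q,S,\Delta,q_0,F)$ with finite state set $Q$, initial state $q_0$, final states $F$, and transitions $\Delta\subseteq Q\times\Sigma\times\mathsf{Op}(S)\times Q$ over a finite alphabet $\Sigma$; runs start at $(q_0,[[\,]])$, each transition $(q,a,\mathsf{op},q')$ changes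 state $q$ to $q'$ and applies $\mathsf{op}$ to the stack (must be defined), and a run is accepting if it ends in a state of $F$. An order-2 nested word (2-NW) over $\Sigma$ is a tuple $\mathcal N=\langle w,\curvearrowright^1,\curvearrowright^2\rangle$, with $w=a_0\cdots a_n\in\Sigma^+$, obtained from a valid sequence of operations $\mathsf{op}_0\cdots\mathsf{op}_n$ (one per position) as follows: $i\curvearrowright^1 j$ iff $\mathsf{op}_j=\downarrow_1$ and the symbol popped at $j$ was pushed by the $\uparrow_1$ at position $i$; $i\curvearrowright^2 j$ iff $\mathsf{op}_j\in\{\downarrow_2,\Downarrow\}$ and $i$ is the position of an $\uparrow_2$ that pushed one of the order-1 stacks removed at $j$. (An $\uparrow_1$ may have several $\curvearrowright^1$-partners; a collapse may have several $\curvearrowright^2$-partners.) $\mathcal L(\mathcal H)$ is the set of 2-NWs generated by accepting runs of $\mathcal H$ (letter and operation of each position given by the transition taken). $\mathsf{LCPDL}$ (PDL with converse and loop) has node formulas $\varphi::=a\mid\varphi\vee\varphi\mid\neg\varphi\mid\langle\pi\rangle\varphi\mid\mathsf{Loop}(\pi)$ ($a\in\Sigma$) and path formulas $\pi::=\{\varphi\}?\mid\rightarrow\mid\leftarrow\mid\curvearrowright^1\mid\curvearrowleft^1\mid\curvearrowright^2\mid\curvearrowleft^2\mid\pi\cdot\pi\mid\pi+\pi\mid\pi^*$, interpreted over positions of a 2-NW: $\rightarrow$ is the successor relation of $w$, $\leftarrow$ its converse, $\curvearrowright^1,\curvearrowright^2$ the nesting relations and $\curvearrowleft^1,\curvearrowleft^2$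 their converses, $\{\varphi\}?$ is the test (identity on positions satisfying $\varphi$), $\cdot,+,{}^*$ are composition, union and reflexive-transitive closure; $\langle\pi\rangle\varphi$ holds at $i$ if some $j$ with $(i,j)\in\pi$ satisfies $\varphi$, and $\mathsf{Loop}(\pi)$ holds at $i$ if $(i,i)\in\pi$. A sentence is a boolean combination of formulas $\mathsf E\varphi$, where $\mathcal N\models\mathsf E\varphi$ iff some position of $\mathcal N$ satisfies $\varphi$. *)

theory Defs
  imports Main "HOL-Library.Nat_Bijection"
begin

datatype recf = Zr | Sc | Pj nat | Cn recf "recf list" | Pr recf recf | Mn recf

inductive reval :: "recf \<Rightarrow> nat list \<Rightarrow> nat \<Rightarrow> bool" where
  zr: "reval Zr xs 0"
| sc: "reval Sc [x] (Suc x)"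
| pj: "i < length xs \<Longrightarrow> reval (Pj i) xs (xs ! i)"
| cn: "list_all2 (\<lambda>g y. reval g xs y) gs ys \<Longrightarrow> reval f ys y \<Longrightarrow> reval (Cn f gs) xs y"
| pr0: "reval f xs y \<Longrightarrow> reval (Pr f g) (0 # xs) y"
| prS: "reval (Pr f g) (n # xs) y \<Longrightarrow> reval g (n # y # xs) z \<Longrightarrow> reval (Pr f g) (Suc n # xs) z"
| mn: "reval f (y # xs) 0 \<Longrightarrow> (\<forall>z<y. \<exists>v. v > 0 \<and> reval f (z # xs) v) \<Longrightarrow> reval (Mn f) xs y"

definition decidable_on :: "'a set \<Rightarrow> ('a \<Rightarrow> nat) \<Rightarrow> ('a \<Rightarrow> bool) \<Rightarrow> bool" where
  "decidable_on D enc P \<longleftrightarrow>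
     (\<exists>f. \<forall>x\<in>D. reval f [enc x] (if P x then 1 else 0))"

datatype 's stackop = Push2 | Pop2 | Push1 's | Pop1 | Collapse | Top 's | TopBot

text \<open>Tagged letters: (stack symbol, collapse link, position of the pushing operation).
  Tagged order-1 stacks: (position of the pushing order-2 push, or None for the initial one,
  contents with the top at the end).  An order-2 stack is a list of order-1 stacks
  u_1 ... u_n, with u_n (the last one) on top.\<close>
type_synonym 's tletter = "'s \<times> nat \<times> nat"
type_synonym 's tstack1 = "nat option \<times> 's tletter list"
type_synonym 's tstack = "'s tstack1 list"
type_synonym rel = "(nat \<times> nat) set"

fun step :: "nat \<Rightarrow> 's stackop \<Rightarrow> 's tstack \<Rightarrow> ('s tstack \<times> rel \<times> rel) option" where
  "step j Push2 st =
     (if st = [] then None else Some (st @ [(Some j, snd (last st))], {}, {}))"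
| "step j Pop2 st =
     (if length st \<le> 1 then None
      else Some (butlast st, {}, {(i, j) | i. fst (last st) = Some i}))"
| "step j (Push1 s) st =
     (if st = [] then None
      else Some (butlast st @ [(fst (last st), snd (last st) @ [(s, length st - 1, j)])], {}, {}))"
| "step j Pop1 st =
     (if st = [] \<or> snd (last st) = [] then None
      else Some (butlast st @ [(fst (last st), butlast (snd (last st)))],
                 {(snd (snd (last (snd (last st)))), j)}, {}))"
| "step j Collapse st =
     (if st = [] \<or> snd (last st) = [] then None
      else (let l = fst (snd (last (snd (last st)))) in
            if l = 0 then None
            else Some (take l st, {}, {(i, j) | i. Some i \<in> fst ` set (drop l st)})))"
| "step j (Top s) st =
     (if st \<noteq> [] \<and> snd (last st) \<noteq> [] \<and> fst (last (snd (last st))) = s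
      then Some (st, {}, {}) else None)"
| "step j TopBot st =
     (if st \<noteq> [] \<and> snd (last st) = [] then Some (st, {}, {}) else None)"

fun run_ops :: "nat \<Rightarrow> 's tstack \<Rightarrow> 's stackop list \<Rightarrow> ('s tstack \<times> rel \<times> rel) option" where
  "run_ops j st [] = Some (st, {}, {})"
| "run_ops j st (o1 # ops) =
     (case step j o1 st of
        None \<Rightarrow> None
      | Some (st', r1, r2) \<Rightarrow>
          (case run_ops (Suc j) st' ops of
             None \<Rightarrow> None
           | Some (st'', R1, R2) \<Rightarrow> Some (st'', r1 \<union> R1, r2 \<union> R2)))"

definition init_stack :: "'s tstack" where
  "init_stack = [(None, [])]"

text \<open>An order-2 nested word over the alphabet of naturals: word, curved-arrow-1, curved-arrow-2.\<close>
type_synonym nw = "nat list \<times> rel \<times> rel"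

definition gen_by :: "nat stackop list \<Rightarrow> nw \<Rightarrow> bool" where
  "gen_by ops N \<longleftrightarrow> (case N of (w, R1, R2) \<Rightarrow>
      w \<noteq> [] \<and> length ops = length w \<and> (\<exists>st. run_ops 0 init_stack ops = Some (st, R1, R2)))"

definition height_bounded_ops :: "nat \<Rightarrow> 's stackop list \<Rightarrow> bool" where
  "height_bounded_ops k ops \<longleftrightarrow>
     (\<forall>m\<le>length ops. \<forall>st R1 R2. run_ops 0 init_stack (take m ops) = Some (st, R1, R2) \<longrightarrow> length st \<le> k)"

definition is_2nw :: "nw \<Rightarrow> bool" where
  "is_2nw N \<longleftrightarrow> (\<exists>ops. gen_by ops N)"

definition is_2nw_nocollapse_bounded :: "nat \<Rightarrow> nw \<Rightarrow> bool" where
  "is_2nw_nocollapse_bounded k N \<longleftrightarrow>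
     (\<exists>ops. gen_by ops N \<and> Collapse \<notin> set ops \<and> height_bounded_ops k ops)"

datatype nform = Atom nat | Or nform nform | Neg nform | Diam pform nform | Loop pform
     and pform = Test nform | Next | Prev | Nest1 | Nest1inv | Nest2 | Nest2inv
               | Seq pform pform | Alt pform pform | Star pform

datatype sentence = E nform | SOr sentence sentence | SNeg sentence

fun sem_n :: "nw \<Rightarrow> nform \<Rightarrow> nat \<Rightarrow> bool"
and sem_p :: "nw \<Rightarrow> pform \<Rightarrow> rel" where
  "sem_n N (Atom a) i = (i < length (fst N) \<and> fst N ! i = a)"
| "sem_n N (Or f g) i = (sem_n N f i \<or> sem_n N g i)"
| "sem_n N (Neg f) i = (\<not> sem_n N f i)"
| "sem_n N (Diam p f) i = (\<exists>j. (i, j) \<in> sem_p N p \<and> sem_n N f j)"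
| "sem_n N (Loop p) i = ((i, i) \<in> sem_p N p)"
| "sem_p N (Test f) = {(i, i) | i. i < length (fst N) \<and> sem_n N f i}"
| "sem_p N Next = {(i, Suc i) | i. Suc i < length (fst N)}"
| "sem_p N Prev = {(Suc i, i) | i. Suc i < length (fst N)}"
| "sem_p N Nest1 = fst (snd N)"
| "sem_p N Nest1inv = (fst (snd N))\<inverse>"
| "sem_p N Nest2 = snd (snd N)"
| "sem_p N Nest2inv = (snd (snd N))\<inverse>"
| "sem_p N (Seq p q) = sem_p N p O sem_p N q"
| "sem_p N (Alt p q) = sem_p N p \<union> sem_p N q"
| "sem_p N (Star p) = Id_on {..<length (fst N)} \<union> (sem_p N p)\<^sup>+"

fun models :: "nw \<Rightarrow> sentence \<Rightarrow> bool" where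
  "models N (E f) = (\<exists>i<length (fst N). sem_n N f i)"
| "models N (SOr s t) = (models N s \<or> models N t)"
| "models N (SNeg s) = (\<not> models N s)"

text \<open>A 2-CPDS (transitions, initial state, final states). States, letters and stack symbols are
  naturals; Q, Sigma and S are the (finite) sets of those occurring.\<close>
type_synonym cpds = "(nat \<times> nat \<times> nat stackop \<times> nat) list \<times> nat \<times> nat list"

fun chain :: "nat \<Rightarrow> (nat \<times> nat \<times> nat stackop \<times> nat) list \<Rightarrow> bool" where
  "chain q [] = True"
| "chain q ((p, a, o1, p') # ts) = (p = q \<and> chain p' ts)"

definition tr_op :: "nat \<times> nat \<times> nat stackop \<times> nat \<Rightarrow> nat stackop" where
  "tr_op t = fst (snd (snd t))"

definition tr_letter :: "nat \<times> nat \<times> nat stackop \<times> nat \<Rightarrow> nat" where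
  "tr_letter t = fst (snd t)"

definition tr_target :: "nat \<times> nat \<times> nat stackop \<times> nat \<Rightarrow> nat" where
  "tr_target t = snd (snd (snd t))"

definition is_run :: "cpds \<Rightarrow> (nat \<times> nat \<times> nat stackop \<times> nat) list \<Rightarrow> bool" where
  "is_run H ts \<longleftrightarrow> set ts \<subseteq> set (fst H) \<and> chain (fst (snd H)) ts
      \<and> run_ops 0 init_stack (map tr_op ts) \<noteq> None"

definition lang :: "cpds \<Rightarrow> nw set" where
  "lang H = {(map tr_letter ts, R1, R2) | ts st R1 R2.
      ts \<noteq> [] \<and> is_run H ts \<and> tr_target (last ts) \<in> set (snd (snd H))
      \<and> run_ops 0 init_stack (map tr_op ts) = Some (st, R1, R2)}"

definition cpds_nocollapse :: "cpds \<Rightarrow> bool" where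
  "cpds_nocollapse H \<longleftrightarrow> (\<forall>t\<in>set (fst H). tr_op t \<noteq> Collapse)"

definition cpds_height_bounded :: "nat \<Rightarrow> cpds \<Rightarrow> bool" where
  "cpds_height_bounded k H \<longleftrightarrow>
     (\<forall>ts st R1 R2. is_run H ts \<longrightarrow> run_ops 0 init_stack (map tr_op ts) = Some (st, R1, R2)
        \<longrightarrow> length st \<le> k)"

fun enc_op :: "nat stackop \<Rightarrow> nat" where
  "enc_op Push2 = prod_encode (0, 0)"
| "enc_op Pop2 = prod_encode (1, 0)"
| "enc_op (Push1 s) = prod_encode (2, s)"
| "enc_op Pop1 = prod_encode (3, 0)"
| "enc_op Collapse = prod_encode (4, 0)"
| "enc_op (Top s) = prod_encode (5, s)"
| "enc_op TopBot = prod_encode (6, 0)"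

fun enc_n :: "nform \<Rightarrow> nat" and enc_p :: "pform \<Rightarrow> nat" where
  "enc_n (Atom a) = prod_encode (0, a)"
| "enc_n (Or f g) = prod_encode (1, prod_encode (enc_n f, enc_n g))"
| "enc_n (Neg f) = prod_encode (2, enc_n f)"
| "enc_n (Diam p f) = prod_encode (3, prod_encode (enc_p p, enc_n f))"
| "enc_n (Loop p) = prod_encode (4, enc_p p)"
| "enc_p (Test f) = prod_encode (0, enc_n f)"
| "enc_p Next = prod_encode (1, 0)"
| "enc_p Prev = prod_encode (2, 0)"
| "enc_p Nest1 = prod_encode (3, 0)"
| "enc_p Nest1inv = prod_encode (4, 0)"
| "enc_p Nest2 = prod_encode (5, 0)"
| "enc_p Nest2inv = prod_encode (6, 0)"
| "enc_p (Seq p q) = prod_encode (7, prod_encode (enc_p p, enc_p q))"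
| "enc_p (Alt p q) = prod_encode (8, prod_encode (enc_p p, enc_p q))"
| "enc_p (Star p) = prod_encode (9, enc_p p)"

fun enc_sent :: "sentence \<Rightarrow> nat" where
  "enc_sent (E f) = prod_encode (0, enc_n f)"
| "enc_sent (SOr s t) = prod_encode (1, prod_encode (enc_sent s, enc_sent t))"
| "enc_sent (SNeg s) = prod_encode (2, enc_sent s)"

definition enc_tr :: "nat \<times> nat \<times> nat stackop \<times> nat \<Rightarrow> nat" where
  "enc_tr t = (case t of (q, a, o1, q') \<Rightarrow> prod_encode (q, prod_encode (a, prod_encode (enc_op o1, q'))))"

definition enc_cpds :: "cpds \<Rightarrow> nat" where
  "enc_cpds H = (case H of (D, q0, F) \<Rightarrow>
      prod_encode (list_encode (map enc_tr D), prod_encode (q0, list_encode F)))"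

definition enc_mc :: "sentence \<times> cpds \<Rightarrow> nat" where
  "enc_mc x = prod_encode (enc_sent (fst x), enc_cpds (snd x))"

definition SAT :: "sentence \<Rightarrow> bool" where
  "SAT \<phi> \<longleftrightarrow> (\<exists>N. is_2nw N \<and> models N \<phi>)"

definition SAT_bounded :: "nat \<Rightarrow> sentence \<Rightarrow> bool" where
  "SAT_bounded k \<phi> \<longleftrightarrow> (\<exists>N. is_2nw_nocollapse_bounded k N \<and> models N \<phi>)"

definition MC :: "sentence \<times> cpds \<Rightarrow> bool" where
  "MC x \<longleftrightarrow> (\<forall>N\<in>lang (snd x). models N (fst x))"

end

theory Submission
  imports Defs
begin

text \<open>Pushing \<open>m\<close> symbols and then repeatedly copying the order-1 stack, emptying the copy and
  removing it, produces a word made of rows of \<open>m\<close> pops, where the pops of one symbol form a column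
  across all rows. A loop that runs to the next row and returns through the common push compares a
  cell with its vertical neighbour. So a row can store the registers of a machine, the value of a
  register being the number of columns marked with it, and a formula can force two consecutive rows
  to be related by an assignment. Path formulas then express programs built from such assignments
  and tests by composition and iteration, and these compute all partial recursive functions.

  Soundness only uses that a pop has at most one matching push, so it holds in every nested word. For the
  diagonal argument, the formula that simulates a recursive function is independent of the input;
  the input is a number of rows in front, counted by iterating a fixed diamond. Hence the code of
  the instance is computable from the code of the formula without decoding it.\<close>

subsection \<open>Recursive functions and diagonalization\<close>

text \<open>The code of the instance has to be computed by one function \<open>W\<close> chosen
  before \<open>g\<close>, since \<open>g\<close> itself is \<open>W\<close> followed by the
  supposed decider. Whatever in the instance depends on \<open>g\<close> must therefore reach
  \<open>W\<close> as an input: the code of the formula as \<open>x\<close> and, for model checking,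
  the code of the automaton as \<open>y\<close>, because its alphabet grows with the number of
  registers. An arbitrary nested word need not look like a grid: a push may have no cell in a row,
  or several. A register is therefore read as the set of pushes marked in a row, not as a number of
  cells, and the formulas state inclusions between such sets of two consecutive rows. Only the
  realisation of a given computation by a word relies on grids, where every column meets every row
  exactly once. Programs are nondeterministic relations. Divergence is then the absence of a path,
  and loops guess their number of rounds and are checked by tests.\<close>

inductive_cases reval_ScE: "reval Sc xs y"
inductive_cases reval_PjE: "reval (Pj i) xs y"
inductive_cases reval_CnE: "reval (Cn f gs) xs y"
inductive_cases reval_ZrE: "reval Zr xs y"
inductive_cases reval_PrE: "reval (Pr f g) xs y"
inductive_cases reval_Pr0E: "reval (Pr f g) (0 # xs) y"
inductive_cases reval_PrSE: "reval (Pr f g) (Suc n # xs) y"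
inductive_cases reval_MnE: "reval (Mn f) xs y"

lemma reval_deterministic:
  "reval f xs y \<Longrightarrow> reval f xs z \<Longrightarrow> y = z"
proof (induction arbitrary: z rule: reval.induct)
  case (cn xs gs ys f y)
  from cn.prems obtain ys' where ys': "list_all2 (\<lambda>g y. reval g xs y) gs ys'" "reval f ys' z"
    by (auto elim: reval_CnE)
  have "ys = ys'"
    using cn.IH(1) ys'(1) by (auto simp: list_all2_conv_all_nth intro!: nth_equalityI)
  then show ?case using cn.IH(2) ys'(2) by simp
next
  case (prS f g n xs y z')
  from prS.prems obtain y' where "reval (Pr f g) (n # xs) y'" "reval g (n # y' # xs) z"
    by (auto elim: reval_PrSE)
  then show ?case using prS.IH by metis
next
  case (mn f y xs)
  from mn.prems have z: "reval f (z # xs) 0" "\<forall>u<z. \<exists>v. v > 0 \<and> reval f (u # xs) v"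
    by (auto elim: reval_MnE)
  \<comment> \<open>The smaller of two distinct results would evaluate both to 0 and to a positive
    value.\<close>
  show ?case
  proof (rule linorder_cases[of y z])
    assume "y < z"
    then show ?thesis using z(2) mn.IH(1) by fastforce
  next
    assume "z < y"
    then show ?thesis using z(1) mn.IH(2) by fastforce
  qed
next
  case (pr0 f xs y g)
  from pr0.prems show ?case by (rule reval_Pr0E) (rule pr0.IH)
qed (auto elim: reval_ScE reval_PjE reval_ZrE)

lemma reval_Cn1:
  "reval g xs y \<Longrightarrow> reval f [y] z \<Longrightarrow> reval (Cn f [g]) xs z"
  by (rule reval.cn[where ys = "[y]"]) auto

lemma reval_Cn2:
  "reval g xs y \<Longrightarrow> reval h xs y' \<Longrightarrow> reval f [y, y'] z \<Longrightarrow> reval (Cn f [g, h]) xs z"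
  by (rule reval.cn[where ys = "[y, y']"]) auto

lemma reval_Pj0: "reval (Pj 0) (x # xs) x"
  using reval.pj[of 0 "x # xs"] by simp

lemma reval_Pj1: "reval (Pj 1) (x # y # xs) y"
  using reval.pj[of 1 "x # y # xs"] by simp

section \<open>Recursive functions acting on codes\<close>

primrec rf_const :: "nat \<Rightarrow> recf" where
  "rf_const 0 = Zr"
| "rf_const (Suc n) = Cn Sc [rf_const n]"

lemma reval_rf_const: "reval (rf_const n) xs n"
  by (induction n) (simp_all add: reval.zr reval_Cn1[OF _ reval.sc])

definition rf_add :: recf where
  "rf_add = Pr (Pj 0) (Cn Sc [Pj 1])"

lemma reval_rf_add: "reval rf_add [a, b] (a + b)"
  unfolding rf_add_def
proof (induction a)
  case 0
  show ?case by (simp add: reval.pr0 reval_Pj0)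
next
  case (Suc a)
  show ?case
    by (rule reval.prS[OF Suc]) (auto intro!: reval_Cn1 reval_Pj1[simplified] reval.sc)
qed

definition rf_triangle :: recf where
  "rf_triangle = Pr Zr (Cn rf_add [Cn Sc [Pj 0], Pj 1])"

lemma reval_rf_triangle: "reval rf_triangle [n] (triangle n)"
  unfolding rf_triangle_def
proof (induction n)
  case 0
  show ?case by (simp add: reval.pr0 reval.zr)
next
  case (Suc n)
  show ?case
    by (rule reval.prS[OF Suc], rule reval_Cn2[OF reval_Cn1[OF reval_Pj0 reval.sc] reval_Pj1])
       (metis reval_rf_add triangle_Suc add.commute)
qed

definition rf_pair :: recf where
  "rf_pair = Cn rf_add [Cn rf_triangle [rf_add], Pj 0]"

lemma reval_rf_pair: "reval rf_pair [a, b] (prod_encode (a, b))"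
  unfolding rf_pair_def prod_encode_def
  by (simp, rule reval_Cn2[OF reval_Cn1[OF reval_rf_add reval_rf_triangle] reval_Pj0 reval_rf_add])

lemma reval_pair_of:
  "reval f xs a \<Longrightarrow> reval g xs b \<Longrightarrow> reval (Cn rf_pair [f, g]) xs (prod_encode (a, b))"
  by (rule reval_Cn2[OF _ _ reval_rf_pair])

text \<open>The tag 3 is that of \<open>Diam\<close> in \<open>enc_n\<close>. The recursion step
  receives the counter and the previous code and only wraps the latter, so it acts on codes whatever
  formula they stand for.\<close>

definition rf_diam_pow :: "pform \<Rightarrow> recf" where
  "rf_diam_pow p = Pr (Pj 0) (Cn rf_pair [rf_const 3, Cn rf_pair [rf_const (enc_p p), Pj 1]])"

lemma reval_rf_diam_pow:
  "reval (rf_diam_pow p) [n, enc_n \<phi>] (enc_n ((Diam p ^^ n) \<phi>))"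
  unfolding rf_diam_pow_def
proof (induction n)
  case 0
  show ?case by (simp add: reval.pr0 reval_Pj0)
next
  case (Suc n)
  show ?case
    by (rule reval.prS[OF Suc], simp) (intro reval_pair_of reval_rf_const reval_Pj1[simplified])
qed

text \<open>Composition with the test for zero, which is the recursion \<open>h\<close> with start
  value 1 and constant step 0. It is there for model checking, which asks about all words of a
  language, while a simulation yields the existence of one.\<close>

lemma decidable_on_not:
  assumes "decidable_on D enc P"
  shows "decidable_on D enc (\<lambda>x. \<not> P x)"
proof -
  from assms obtain f where f: "\<And>x. x \<in> D \<Longrightarrow> reval f [enc x] (if P x then 1 else 0)"
    unfolding decidable_on_def by blast
  define h where "h = Pr (rf_const 1) Zr"
  have h: "reval h [n] (if n = 0 then 1 else 0)" for n
  proof (induction n)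
    case 0
    show ?case unfolding h_def by (simp add: reval.pr0 reval_rf_const del: rf_const.simps One_nat_def)
  next
    case (Suc n)
    then show ?case unfolding h_def by (auto intro: reval.prS reval.zr)
  qed
  have "reval (Cn h [f]) [enc x] (if \<not> P x then 1 else 0)" if "x \<in> D" for x
    using reval_Cn1[OF f[OF that] h] by (simp split: if_splits)
  then show ?thesis unfolding decidable_on_def by blast
qed

text \<open>\<open>Mn (Pj 1)\<close> returns 0 on the input 0 and diverges on every other input.
  Hence the \<open>g\<close> built from \<open>W\<close> and a decider \<open>f\<close> halts, with
  result 0, exactly if \<open>f\<close> rejects the instance that simulates \<open>g\<close>. The
  two implications leave open what \<open>P X\<close> is when \<open>g\<close> has a result other
  than 0; this \<open>g\<close> has none.\<close>

lemma undecidable_by_diagonalization: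
  assumes simulates: "\<And>g. \<exists>x y X. X \<in> D \<and> reval W [x, y] (enc X)
      \<and> (reval g [x, y] 0 \<longrightarrow> P X) \<and> (P X \<longrightarrow> (\<exists>v. reval g [x, y] v))"
  shows "\<not> decidable_on D enc P"
proof
  assume "decidable_on D enc P"
  then obtain f where f: "\<And>X. X \<in> D \<Longrightarrow> reval f [enc X] (if P X then 1 else 0)"
    unfolding decidable_on_def by blast
  define g where "g = Cn (Mn (Pj 1)) [Cn f [W]]"
  obtain x y X where X: "X \<in> D" "reval W [x, y] (enc X)"
    and halt: "reval g [x, y] 0 \<longrightarrow> P X" "P X \<longrightarrow> (\<exists>v. reval g [x, y] v)"
    using simulates by blast
  show False
  proof (cases "P X")
    case False
    have "reval (Mn (Pj 1)) [0] 0"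
      by (rule reval.mn) (use reval_Pj1[of 0 0] in auto)
    then have "reval g [x, y] 0"
      unfolding g_def using f[OF X(1)] False X(2) by (auto intro!: reval_Cn1)
    then show False using halt(1) False by blast
  next
    case True
    then obtain v where "reval g [x, y] v" using halt(2) by blast
    then obtain u e where u: "reval W [x, y] e" "reval f [e] u" "reval (Mn (Pj 1)) [u] v"
      unfolding g_def by (auto elim!: reval_CnE simp: list_all2_Cons1)
    have "u = 0"
      using u(3) by (auto elim!: reval_MnE reval_PjE)
    moreover have "e = enc X" using reval_deterministic[OF u(1) X(2)] .
    ultimately show False
      using reval_deterministic[OF u(2)] f[OF X(1)] True by auto
  qed
qed

subsection \<open>Programs computing recursive functions\<close>

type_synonym store = "nat \<Rightarrow> nat"

datatype expr = Zero | Val nat | Succ nat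

fun eval_expr :: "expr \<Rightarrow> store \<Rightarrow> nat" where
  "eval_expr Zero s = 0"
| "eval_expr (Val x) s = s x"
| "eval_expr (Succ x) s = Suc (s x)"

text \<open>Every constructor has a path formula of the same kind: \<open>Then\<close> and
  \<open>Iter\<close> become \<open>Seq\<close> and \<open>Star\<close>, the conditions become
  \<open>Test\<close>, and an assignment is one step to the following row.\<close>

datatype prog = Assign nat expr | IfEq nat nat | IfZero nat | IfPos nat
  | Then prog prog | Iter prog

fun psem :: "prog \<Rightarrow> (store \<times> store) set" where
  "psem (Assign r e) = {(s, s(r := eval_expr e s)) | s. True}"
| "psem (IfEq x y) = {(s, s) | s. s x = s y}"
| "psem (IfZero x) = {(s, s) | s. s x = 0}"
| "psem (IfPos x) = {(s, s) | s. s x > 0}"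
| "psem (Then p q) = psem p O psem q"
| "psem (Iter p) = (psem p)\<^sup>*"

lemma mem_psem [simp]:
  "(s, t) \<in> psem (Assign r e) \<longleftrightarrow> t = s(r := eval_expr e s)"
  "(s, t) \<in> psem (IfEq x y) \<longleftrightarrow> t = s \<and> s x = s y"
  "(s, t) \<in> psem (IfZero x) \<longleftrightarrow> t = s \<and> s x = 0"
  "(s, t) \<in> psem (IfPos x) \<longleftrightarrow> t = s \<and> s x > 0"
  "(s, t) \<in> psem (Then p q) \<longleftrightarrow> (\<exists>u. (s, u) \<in> psem p \<and> (u, t) \<in> psem q)"
  "(s, t) \<in> psem (Iter p) \<longleftrightarrow> (s, t) \<in> (psem p)\<^sup>*"
  by auto

declare psem.simps [simp del]

abbreviation skip :: prog where "skip \<equiv> IfEq 0 0"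
abbreviation fail :: prog where "fail \<equiv> Then (IfZero 0) (IfPos 0)"

text \<open>The program \<open>compile g is r b\<close> applies \<open>g\<close> to the registers \<open>is\<close>, puts the result
  into \<open>r\<close>, and uses the registers from \<open>b\<close> on as scratch space.\<close>

fun compile :: "recf \<Rightarrow> nat list \<Rightarrow> nat \<Rightarrow> nat \<Rightarrow> prog"
and compile_list :: "recf list \<Rightarrow> nat list \<Rightarrow> nat \<Rightarrow> nat \<Rightarrow> prog" where
  "compile Zr is r b = Assign r Zero"
| "compile Sc is r b = (if length is = 1 then Assign r (Succ (hd is)) else fail)"
| "compile (Pj i) is r b = (if i < length is then Assign r (Val (is ! i)) else fail)"
| "compile (Cn f gs) is r b =
     Then (compile_list gs is b (b + length gs))
          (compile f [b..<b + length gs] r (b + length gs))"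
| "compile (Pr f g) is r b = (if is = [] then fail else
     Then (Assign b Zero) (Then (compile f (tl is) (b + 1) (b + 3))
       (Then (Iter (Then (compile g (b # (b + 1) # tl is) (b + 2) (b + 3))
                     (Then (Assign (b + 1) (Val (b + 2))) (Assign b (Succ b)))))
         (Then (IfEq b (hd is)) (Assign r (Val (b + 1)))))))"
| "compile (Mn f) is r b =
     Then (Assign b Zero)
       (Then (Iter (Then (compile f (b # is) (b + 1) (b + 2))
                     (Then (IfPos (b + 1)) (Assign b (Succ b)))))
         (Then (compile f (b # is) (b + 1) (b + 2))
           (Then (IfZero (b + 1)) (Assign r (Val b)))))"
| "compile_list [] is r b = skip"
| "compile_list (g # gs) is r b = Then (compile g is r b) (compile_list gs is (Suc r) b)"

text \<open>Programs are relations, so two halves are needed: every run ends with a value of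
  \<open>F\<close>, and every value of \<open>F\<close> is reached by a run. If \<open>F\<close> has
  no value at a store, no run starts there. Registers from \<open>b\<close> on are unconstrained at
  the end and can serve as scratch space.\<close>

definition computes :: "prog \<Rightarrow> nat \<Rightarrow> nat \<Rightarrow> (store \<Rightarrow> nat \<Rightarrow> bool) \<Rightarrow> bool" where
  "computes P b r F \<longleftrightarrow>
     (\<forall>s t. (s, t) \<in> psem P \<longrightarrow> F s (t r) \<and> (\<forall>i<b. i \<noteq> r \<longrightarrow> t i = s i)) \<and>
     (\<forall>s y. F s y \<longrightarrow> (\<exists>t. (s, t) \<in> psem P \<and> t r = y))"

lemma computesD:
  assumes "computes P b r F" "(s, t) \<in> psem P"
  shows "F s (t r)" "i < b \<Longrightarrow> i \<noteq> r \<Longrightarrow> t i = s i"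
  using assms unfolding computes_def by blast+

lemma computes_ex:
  assumes "computes P b r F" "F s y"
  obtains t where "(s, t) \<in> psem P" "t r = y" "\<And>i. i < b \<Longrightarrow> i \<noteq> r \<Longrightarrow> t i = s i"
  using assms unfolding computes_def by blast

lemma computes_fail: "(\<And>s y. \<not> F s y) \<Longrightarrow> computes fail b r F"
  unfolding computes_def by auto

lemma map_eq_below:
  assumes "set is \<subseteq> {..<b}" "\<And>i. i < b \<Longrightarrow> t i = s i"
  shows "map t is = map s is"
  using assms by (auto simp: subset_eq)

text \<open>\<open>Iter\<close> guesses the number of rounds, and the test \<open>IfEq b i\<close>
  discards wrong guesses. The invariant refers to the counter \<open>b\<close> instead of the number
  of rounds: register \<open>b + 1\<close> holds the value of the recursion at the present
  counter.\<close>

lemma computes_Pr: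
  assumes F: "computes P (b + 3) (b + 1) (\<lambda>s. reval f (map s is))"
    and G: "computes Q (b + 3) (b + 2) (\<lambda>s. reval g (map s (b # (b + 1) # is)))"
    and i: "i < b" and isb: "set is \<subseteq> {..<b}" and r: "r < b"
  shows "computes (Then (Assign b Zero) (Then P
       (Then (Iter (Then Q (Then (Assign (b + 1) (Val (b + 2))) (Assign b (Succ b)))))
         (Then (IfEq b i) (Assign r (Val (b + 1)))))))
     b r (\<lambda>s. reval (Pr f g) (map s (i # is)))"
    (is "computes (Then _ (Then _ (Then (Iter ?B) _))) _ _ _")
  unfolding computes_def
proof (intro conjI allI impI)
  define inv where "inv s t \<longleftrightarrow> reval (Pr f g) (t b # map s is) (t (b + 1)) \<and> (\<forall>i<b. t i = s i)"
    for s t :: store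
  have start: "inv s u" if "(s(b := 0), u) \<in> psem P" for s u
  proof -
    have "reval f (map (s(b := 0)) is) (u (b + 1))" and fr: "\<And>j. j < b + 3 \<Longrightarrow> j \<noteq> b + 1 \<Longrightarrow> u j = (s(b := 0)) j"
      using computesD[OF F that] by auto
    moreover have "map (s(b := 0)) is = map s is"
      using isb by (intro map_eq_below) auto
    moreover have "u b = 0" using fr[of b] by simp
    ultimately show ?thesis
      unfolding inv_def using reval.pr0[of f "map s is"] by auto
  qed
  have inv_step: "inv s v" if "inv s u" "(u, v) \<in> psem ?B" for s u v
  proof -
    from that(2) obtain z where z: "(u, z) \<in> psem Q" "v = z(b + 1 := z (b + 2), b := Suc (z b))"
      by auto
    have "reval g (map u (b # (b + 1) # is)) (z (b + 2))"
      and fr: "\<And>j. j < b + 3 \<Longrightarrow> j \<noteq> b + 2 \<Longrightarrow> z j = u j"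
      using computesD[OF G z(1)] by auto
    moreover have "map u is = map s is"
      using that(1) isb by (intro map_eq_below) (auto simp: inv_def)
    ultimately have "reval (Pr f g) (Suc (u b) # map s is) (z (b + 2))"
      using that(1) unfolding inv_def by (auto intro: reval.prS)
    then show ?thesis
      using z(2) fr that(1) unfolding inv_def by auto
  qed
  have steps: "inv s v" if "(u, v) \<in> (psem ?B)\<^sup>*" "inv s u" for s u v
    using that by induction (blast intro: inv_step)+
  {
    fix s t
    assume "(s, t) \<in> psem (Then (Assign b Zero) (Then P (Then (Iter ?B)
         (Then (IfEq b i) (Assign r (Val (b + 1)))))))"
    then obtain u v where uv: "(s(b := 0), u) \<in> psem P" "(u, v) \<in> (psem ?B)\<^sup>*" "v b = v i"
      "t = v(r := v (b + 1))" by auto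
    have "inv s v" using steps uv start by blast
    then show "reval (Pr f g) (map s (i # is)) (t r)" "\<And>j. j < b \<Longrightarrow> j \<noteq> r \<Longrightarrow> t j = s j"
      using uv i unfolding inv_def by auto
  }
  \<comment> \<open>Conversely, every value of the recursion is reached, by induction on its
    argument: one more round is appended to the run.\<close>
  have reach: "\<exists>u v. (s(b := 0), u) \<in> psem P \<and> (u, v) \<in> (psem ?B)\<^sup>* \<and> v b = n \<and> v (b + 1) = y"
    if "reval (Pr f g) (n # map s is) y" for s n y
    using that
  proof (induction n arbitrary: y)
    case 0
    then have "reval f (map s is) y" by (auto elim: reval_Pr0E)
    moreover have "map (s(b := 0)) is = map s is"
      using isb by (intro map_eq_below) auto
    ultimately have "reval f (map (s(b := 0)) is) y" by (simp only:)
    from computes_ex[OF F, where s = "s(b := 0)" and y = y, OF this] obtain u where u: "(s(b := 0), u) \<in> psem P" "u (b + 1) = y"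
      "\<And>j. j < b + 3 \<Longrightarrow> j \<noteq> b + 1 \<Longrightarrow> u j = (s(b := 0)) j"
      by blast
    from u(3)[of b] have "u b = 0" by simp
    with u show ?case by blast
  next
    case (Suc n)
    then obtain y' where y': "reval (Pr f g) (n # map s is) y'" "reval g (n # y' # map s is) y"
      by (auto elim: reval_PrSE)
    from Suc.IH[OF y'(1)] obtain u v where uv: "(s(b := 0), u) \<in> psem P"
      "(u, v) \<in> (psem ?B)\<^sup>*" "v b = n" "v (b + 1) = y'" by blast
    have "inv s v" using steps uv start by blast
    then have m: "map v is = map s is"
      using isb by (intro map_eq_below) (auto simp: inv_def)
    have "reval g (map v (b # (b + 1) # is)) y"
      unfolding list.map m uv(3,4) by (rule y'(2))
    from computes_ex[OF G, where s = v and y = y, OF this] obtain z where z: "(v, z) \<in> psem Q" "z (b + 2) = y"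
      "\<And>j. j < b + 3 \<Longrightarrow> j \<noteq> b + 2 \<Longrightarrow> z j = v j"
      by blast
    have "(v, z(b + 1 := z (b + 2), b := Suc (z b))) \<in> psem ?B" using z by auto
    then have "(u, z(b + 1 := z (b + 2), b := Suc (z b))) \<in> (psem ?B)\<^sup>*"
      using uv(2) by (rule rtrancl_into_rtrancl[rotated])
    moreover have "z b = n" using z(3)[of b] uv(3) by simp
    ultimately show ?case using uv(1) z(2) by fastforce
  qed
  fix s y
  assume "reval (Pr f g) (map s (i # is)) y"
  then obtain u v where uv: "(s(b := 0), u) \<in> psem P" "(u, v) \<in> (psem ?B)\<^sup>*"
    "v b = s i" "v (b + 1) = y" using reach[of "s i" s y] by auto
  have "inv s v" using steps uv start by blast
  then have "v b = v i" using i uv unfolding inv_def by auto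
  then show "\<exists>t. (s, t) \<in> psem (Then (Assign b Zero) (Then P (Then (Iter ?B)
         (Then (IfEq b i) (Assign r (Val (b + 1))))))) \<and> t r = y"
    using uv by (intro exI[of _ "v(r := v (b + 1))"]) auto
qed

text \<open>\<open>IfPos\<close> in the loop admits a further round only after a positive value, and
  the final \<open>IfZero\<close> requires a zero; so a run that passes all tests stops at the least
  zero. An undefined value of \<open>f\<close> below the zero blocks the run, as the rule
  \<open>mn\<close> demands.\<close>

lemma computes_Mn:
  assumes F: "computes P (b + 2) (b + 1) (\<lambda>s. reval f (map s (b # is)))"
    and isb: "set is \<subseteq> {..<b}" and r: "r < b"
  shows "computes (Then (Assign b Zero)
       (Then (Iter (Then P (Then (IfPos (b + 1)) (Assign b (Succ b)))))
         (Then P (Then (IfZero (b + 1)) (Assign r (Val b))))))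
     b r (\<lambda>s. reval (Mn f) (map s is))"
    (is "computes (Then _ (Then (Iter ?B) _)) _ _ _")
  unfolding computes_def
proof (intro conjI allI impI)
  define inv where "inv s t \<longleftrightarrow> (\<forall>z<t b. \<exists>v>0. reval f (z # map s is) v) \<and> (\<forall>i<b. t i = s i)"
    for s t :: store
  have evals: "reval f (u b # map s is) (v (b + 1))" "v b = u b" "\<forall>i<b. v i = s i"
    if "inv s u" "(u, v) \<in> psem P" for s u v
  proof -
    have m: "map u is = map s is"
      using that(1) isb by (intro map_eq_below) (auto simp: inv_def)
    show "reval f (u b # map s is) (v (b + 1))"
      using computesD(1)[OF F that(2)] unfolding list.map m .
    show "v b = u b" "\<forall>i<b. v i = s i"
      using computesD(2)[OF F that(2)] that(1) unfolding inv_def by auto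
  qed
  have inv_step: "inv s v" if "inv s u" "(u, v) \<in> psem ?B" for s u v
  proof -
    from that(2) obtain z where z: "(u, z) \<in> psem P" "z (b + 1) > 0" "v = z(b := Suc (z b))"
      by auto
    note e = evals[OF that(1) z(1)]
    have "\<exists>y>0. reval f (i # map s is) y" if "i < Suc (u b)" for i
      using e(1) z(2) \<open>inv s u\<close> that unfolding inv_def less_Suc_eq by blast
    then show ?thesis
      using e(2,3) z(3) unfolding inv_def by simp
  qed
  have steps: "inv s v" if "(s(b := 0), v) \<in> (psem ?B)\<^sup>*" for s v
    using that
  proof induction
    case base
    show ?case by (simp add: inv_def)
  qed (blast intro: inv_step)
  {
    fix s t
    assume "(s, t) \<in> psem (Then (Assign b Zero) (Then (Iter ?B)
         (Then P (Then (IfZero (b + 1)) (Assign r (Val b))))))"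
    then obtain u v where uv: "(s(b := 0), u) \<in> (psem ?B)\<^sup>*" "(u, v) \<in> psem P" "v (b + 1) = 0"
      "t = v(r := v b)" by auto
    note e = evals[OF steps[OF uv(1)] uv(2)]
    have "reval (Mn f) (map s is) (u b)"
      using e(1) uv(3) steps[OF uv(1)] unfolding inv_def by (intro reval.mn) auto
    then show "reval (Mn f) (map s is) (t r)" using e(2) uv(4) by simp
    show "\<And>j. j < b \<Longrightarrow> j \<noteq> r \<Longrightarrow> t j = s j"
      using e(3) uv(4) by simp
  }
  have reach: "\<exists>v. (s(b := 0), v) \<in> (psem ?B)\<^sup>* \<and> v b = n"
    if "\<forall>z<n. \<exists>v>0. reval f (z # map s is) v" for s n
    using that
  proof (induction n)
    case 0
    then show ?case by (intro exI[of _ "s(b := 0)"]) auto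
  next
    case (Suc n)
    have "\<forall>z<n. \<exists>v>0. reval f (z # map s is) v" using Suc.prems by simp
    from Suc.IH[OF this] obtain v where v: "(s(b := 0), v) \<in> (psem ?B)\<^sup>*" "v b = n"
      by blast
    have m: "map v is = map s is"
      using steps[OF v(1)] isb by (intro map_eq_below) (auto simp: inv_def)
    obtain y where y: "y > 0" "reval f (n # map s is) y" using Suc.prems by auto
    have "reval f (map v (b # is)) y" unfolding list.map m v(2) by (rule y(2))
    from computes_ex[OF F, where s = v and y = y, OF this] obtain z where z: "(v, z) \<in> psem P" "z (b + 1) > 0"
      using y(1) by metis
    then have "(v, z(b := Suc (z b))) \<in> psem ?B" by auto
    then have "(s(b := 0), z(b := Suc (z b))) \<in> (psem ?B)\<^sup>*"
      using v(1) by (rule rtrancl_into_rtrancl[rotated])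
    moreover have "(z(b := Suc (z b))) b = Suc n" using evals[OF steps[OF v(1)] z(1)] v(2) by simp
    ultimately show ?case by blast
  qed
  fix s y
  assume "reval (Mn f) (map s is) y"
  then have y: "reval f (y # map s is) 0" "\<forall>z<y. \<exists>v>0. reval f (z # map s is) v"
    by (auto elim: reval_MnE)
  then obtain u where u: "(s(b := 0), u) \<in> (psem ?B)\<^sup>*" "u b = y" using reach by blast
  have m: "map u is = map s is"
    using steps[OF u(1)] isb by (intro map_eq_below) (auto simp: inv_def)
  have "reval f (map u (b # is)) 0" unfolding list.map m u(2) by (rule y(1))
  from computes_ex[OF F, where s = u and y = 0, OF this] obtain v where v: "(u, v) \<in> psem P" "v (b + 1) = 0"
    by blast
  have "v b = y" using evals[OF steps[OF u(1)] v(1)] u(2) by simp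
  then show "\<exists>t. (s, t) \<in> psem (Then (Assign b Zero) (Then (Iter ?B)
         (Then P (Then (IfZero (b + 1)) (Assign r (Val b)))))) \<and> t r = y"
    using u(1) v by (intro exI[of _ "v(r := v b)"]) auto
qed

text \<open>For lists the arguments must lie below \<open>r\<close>, since the results are stored
  from \<open>r\<close> on while later functions still read the arguments. For a single function
  \<open>r\<close> may be one of the arguments.\<close>

lemma computes_compile:
  "set is \<subseteq> {..<b} \<Longrightarrow> r < b \<Longrightarrow> computes (compile g is r b) b r (\<lambda>s. reval g (map s is))"
  and computes_compile_list:
  "set is \<subseteq> {..<r} \<Longrightarrow> r + length gs \<le> b \<Longrightarrow>
     (\<forall>s t. (s, t) \<in> psem (compile_list gs is r b) \<longrightarrow>
        list_all2 (\<lambda>g. reval g (map s is)) gs (map t [r..<r + length gs]) \<and> (\<forall>i<r. t i = s i)) \<and>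
     (\<forall>s ys. list_all2 (\<lambda>g. reval g (map s is)) gs ys \<longrightarrow>
        (\<exists>t. (s, t) \<in> psem (compile_list gs is r b) \<and> map t [r..<r + length gs] = ys))"
proof (induction g "is" r b and gs "is" r b rule: compile_compile_list.induct)
  case (1 "is" r b)
  show ?case by (auto simp: computes_def intro: reval.zr elim: reval_ZrE)
next
  case (2 "is" r b)
  show ?case
  proof (cases "length is = 1")
    case True
    then obtain i where "is = [i]" by (auto simp: length_Suc_conv)
    then show ?thesis by (auto simp: computes_def intro: reval.sc elim: reval_ScE)
  next
    case False
    then have "computes fail b r (\<lambda>s. reval Sc (map s is))"
      by (intro computes_fail) (auto elim!: reval_ScE)
    with False show ?thesis by simp
  qed
next
  case (3 i "is" r b)
  show ?case
  proof (cases "i < length is")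
    case True
    then have "reval (Pj i) (map s is) (s (is ! i))" for s
      using reval.pj[of i "map s is"] by simp
    with True show ?thesis by (auto simp: computes_def elim: reval_PjE)
  next
    case False
    then have "computes fail b r (\<lambda>s. reval (Pj i) (map s is))"
      by (intro computes_fail) (auto elim!: reval_PjE)
    with False show ?thesis by simp
  qed
next
  case (4 f gs "is" r b)
  let ?n = "length gs" and ?L = "compile_list gs is b (b + length gs)"
  note L = "4.IH"(1)[OF "4.prems"(1) order.refl]
  have F: "computes (compile f [b..<b + ?n] r (b + ?n)) (b + ?n) r (\<lambda>s. reval f (map s [b..<b + ?n]))"
    using "4.prems" by (intro "4.IH"(2)) auto
  show ?case
    unfolding computes_def
  proof (intro conjI allI impI)
    fix s t assume "(s, t) \<in> psem (compile (Cn f gs) is r b)"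
    then obtain u where u: "(s, u) \<in> psem ?L" "(u, t) \<in> psem (compile f [b..<b + ?n] r (b + ?n))"
      by auto
    show "reval (Cn f gs) (map s is) (t r)"
      using L u(1) computesD(1)[OF F u(2)] by (blast intro: reval.cn)
    show "t i = s i" if "i < b" "i \<noteq> r" for i
      using L u(1) computesD(2)[OF F u(2), of i] that by auto
  next
    fix s y assume "reval (Cn f gs) (map s is) y"
    then obtain ys where "list_all2 (\<lambda>g y. reval g (map s is) y) gs ys" "reval f ys y"
      by (auto elim: reval_CnE)
    then obtain u where u: "(s, u) \<in> psem ?L" "reval f (map u [b..<b + ?n]) y"
      using L[THEN conjunct2, rule_format, of s ys] by metis
    obtain t where "(u, t) \<in> psem (compile f [b..<b + ?n] r (b + ?n))" "t r = y"
      by (rule computes_ex[OF F, where s = u and y = y, OF u(2)])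
    then show "\<exists>t. (s, t) \<in> psem (compile (Cn f gs) is r b) \<and> t r = y"
      using u(1) by auto
  qed
next
  case (5 f g "is" r b)
  show ?case
  proof (cases "is")
    case Nil
    then have "computes fail b r (\<lambda>s. reval (Pr f g) (map s is))"
      by (intro computes_fail) (auto elim!: reval_PrE)
    with Nil show ?thesis by simp
  next
    case (Cons i js)
    have "computes (compile f js (b + 1) (b + 3)) (b + 3) (b + 1) (\<lambda>s. reval f (map s js))"
      using "5.IH"(1) "5.prems" Cons by (fastforce simp: subset_eq)
    moreover have "computes (compile g (b # (b + 1) # js) (b + 2) (b + 3)) (b + 3) (b + 2)
        (\<lambda>s. reval g (map s (b # (b + 1) # js)))"
      using "5.IH"(2) "5.prems" Cons by (fastforce simp: subset_eq)
    ultimately show ?thesis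
      using computes_Pr[of _ b f js _ g i r] "5.prems" Cons by simp
  qed
next
  case (6 f "is" r b)
  have "computes (compile f (b # is) (b + 1) (b + 2)) (b + 2) (b + 1) (\<lambda>s. reval f (map s (b # is)))"
    using "6.IH" "6.prems" by (fastforce simp: subset_eq)
  from computes_Mn[OF this "6.prems"] show ?case by simp
next
  case (7 "is" r b)
  show ?case by auto
next
  case (8 g gs "is" r b)
  have G: "computes (compile g is r b) b r (\<lambda>s. reval g (map s is))"
    using "8.prems" by (intro "8.IH"(1)) (auto simp: subset_eq)
  have sub: "set is \<subseteq> {..<Suc r}" "Suc r + length gs \<le> b"
    using "8.prems" by (auto simp: subset_eq less_Suc_eq)
  note GS = "8.IH"(2)[OF sub]
  have eq: "map u is = map s is" if "(s, u) \<in> psem (compile g is r b)" for s u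
    using computesD(2)[OF G that] "8.prems" by (intro map_eq_below[of _ r]) auto
  have upt: "[r..<r + length (g # gs)] = r # [Suc r..<Suc r + length gs]"
    by (simp add: upt_rec)
  show ?case
  proof (intro conjI allI impI)
    fix s t assume "(s, t) \<in> psem (compile_list (g # gs) is r b)"
    then obtain u where u: "(s, u) \<in> psem (compile g is r b)"
      "(u, t) \<in> psem (compile_list gs is (Suc r) b)" by auto
    from GS u(2) have t: "list_all2 (\<lambda>g. reval g (map u is)) gs (map t [Suc r..<Suc r + length gs])"
      "\<And>i. i < Suc r \<Longrightarrow> t i = u i" by blast+
    show "list_all2 (\<lambda>g. reval g (map s is)) (g # gs) (map t [r..<r + length (g # gs)])"
      unfolding upt using t computesD(1)[OF G u(1)] eq[OF u(1)] by simp
    show "t i = s i" if "i < r" for i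
      using t(2)[of i] computesD(2)[OF G u(1), of i] that "8.prems" by auto
  next
    fix s ys assume "list_all2 (\<lambda>g. reval g (map s is)) (g # gs) ys"
    then obtain y zs where ys: "ys = y # zs" "reval g (map s is) y"
      "list_all2 (\<lambda>g. reval g (map s is)) gs zs" by (auto simp: list_all2_Cons1)
    from computes_ex[OF G, where s = s and y = y, OF ys(2)] obtain u where u: "(s, u) \<in> psem (compile g is r b)" "u r = y"
      by blast
    obtain t where t: "(u, t) \<in> psem (compile_list gs is (Suc r) b)"
      "map t [Suc r..<Suc r + length gs] = zs"
      using GS ys(3) eq[OF u(1)] by metis
    moreover have "t r = u r" using GS t(1) by blast
    ultimately show "\<exists>t. (s, t) \<in> psem (compile_list (g # gs) is r b) \<and>
        map t [r..<r + length (g # gs)] = ys"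
      unfolding upt using u ys by (intro exI[of _ t]) auto
  qed
qed

section \<open>Computations laid out along a list of stores\<close>

primrec regs_expr :: "expr \<Rightarrow> nat" where
  "regs_expr Zero = 0"
| "regs_expr (Val x) = Suc x"
| "regs_expr (Succ x) = Suc x"

primrec regs :: "prog \<Rightarrow> nat" where
  "regs (Assign r e) = max (Suc r) (regs_expr e)"
| "regs (IfEq x y) = max (Suc x) (Suc y)"
| "regs (IfZero x) = Suc x"
| "regs (IfPos x) = Suc x"
| "regs (Then p q) = max (regs p) (regs q)"
| "regs (Iter p) = regs p"

text \<open>The path semantics of a program over a list of stores, with the shape that
  \<open>sem_p\<close> has over a word: an assignment moves to the next index, a test stays. It
  separates the choice of a run from its realisation by rows.\<close>

fun along :: "store list \<Rightarrow> prog \<Rightarrow> (nat \<times> nat) set" where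
  "along L (Assign r e) =
     {(i, Suc i) | i. Suc i < length L \<and> L ! Suc i = (L ! i)(r := eval_expr e (L ! i))}"
| "along L (IfEq x y) = {(i, i) | i. i < length L \<and> (L ! i) x = (L ! i) y}"
| "along L (IfZero x) = {(i, i) | i. i < length L \<and> (L ! i) x = 0}"
| "along L (IfPos x) = {(i, i) | i. i < length L \<and> (L ! i) x > 0}"
| "along L (Then p q) = along L p O along L q"
| "along L (Iter p) = Id_on {..<length L} \<union> (along L p)\<^sup>+"

text \<open>The trace \<open>T\<close> has to work in every context, because the traces of composed
  programs become neighbours in one list, and the rows for the input come in front of them.\<close>

lemma psem_along:
  assumes "(s, t) \<in> psem p"
  shows "\<exists>T. last (s # T) = t \<and>
    (\<forall>pre post. (length pre, length pre + length T) \<in> along (pre @ (s # T) @ post) p)"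
proof -
  have glue: "\<exists>T. last (s # T) = u \<and>
      (\<forall>pre post. (length pre, length pre + length T) \<in> A (pre @ (s # T) @ post) O B (pre @ (s # T) @ post))"
    if 1: "\<exists>T. last (s # T) = t \<and>
      (\<forall>pre post. (length pre, length pre + length T) \<in> A (pre @ (s # T) @ post))"
    and 2: "\<exists>T. last (t # T) = u \<and>
      (\<forall>pre post. (length pre, length pre + length T) \<in> B (pre @ (t # T) @ post))"
    for s t u :: store and A B :: "store list \<Rightarrow> (nat \<times> nat) set"
  proof -
    from 1 obtain T1 where T1: "last (s # T1) = t"
      "\<And>pre post. (length pre, length pre + length T1) \<in> A (pre @ (s # T1) @ post)" by blast
    from 2 obtain T2 where T2: "last (t # T2) = u"
      "\<And>pre post. (length pre, length pre + length T2) \<in> B (pre @ (t # T2) @ post)" by blast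
    \<comment> \<open>The two traces share the store \<open>t\<close>, so the context in front of
      the second one ends with \<open>butlast (s # T1)\<close>.\<close>
    have split: "s # T1 = butlast (s # T1) @ [t]"
      using T1(1) by (metis append_butlast_last_id list.discI)
    have "(length pre, length pre + length (T1 @ T2)) \<in>
        A (pre @ (s # (T1 @ T2)) @ post) O B (pre @ (s # (T1 @ T2)) @ post)" for pre post
    proof -
      have "(length pre, length pre + length T1) \<in> A (pre @ (s # (T1 @ T2)) @ post)"
        using T1(2)[of pre "T2 @ post"] by simp
      moreover have "(pre @ butlast (s # T1)) @ (t # T2) @ post = pre @ (s # (T1 @ T2)) @ post"
        using split by (metis append.assoc append_Cons append_Nil)
      then have "(length pre + length T1, length pre + length (T1 @ T2)) \<in> B (pre @ (s # (T1 @ T2)) @ post)"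
        using T2(2)[of "pre @ butlast (s # T1)" post]
        by (simp only: length_append length_butlast list.size diff_Suc_1 add_Suc_right add_0_right add.assoc)
      ultimately show ?thesis by blast
    qed
    moreover have "last (s # T1 @ T2) = u"
      using T1(1) T2(1) by (cases "T2 = []") (auto simp: last_append)
    ultimately show ?thesis by blast
  qed
  show ?thesis using assms
  proof (induction p arbitrary: s t)
    case (Assign r e)
    then show ?case by (intro exI[of _ "[t]"]) (auto simp: nth_append)
  next
    case (Then p q)
    then obtain u where "(s, u) \<in> psem p" "(u, t) \<in> psem q" by auto
    then show ?case
      using glue[where A = "\<lambda>L. along L p" and B = "\<lambda>L. along L q", OF Then.IH] by simp
  next
    case (Iter p)
    then have "(s, t) \<in> (psem p)\<^sup>*" by simp
    then show ?case
    proof (induction rule: converse_rtrancl_induct)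
      case base
      show ?case by (intro exI[of _ "[]"]) auto
    next
      case (step s u)
      have *: "along L p O along L (Iter p) \<subseteq> along L (Iter p)" for L
        by (auto intro: trancl_into_trancl2)
      show ?case
        using glue[where A = "\<lambda>L. along L p" and B = "\<lambda>L. along L (Iter p)",
            OF Iter.IH[OF step(1)] step.IH] * by blast
    qed
  next
    case (IfEq x y)
    then show ?case by (intro exI[of _ "[]"]) (simp add: nth_append)
  next
    case (IfZero x)
    then show ?case by (intro exI[of _ "[]"]) (simp add: nth_append)
  next
    case (IfPos x)
    then show ?case by (intro exI[of _ "[]"]) (simp add: nth_append)
  qed
qed

subsection \<open>Programs as path formulas\<close>

definition ftrue :: nform where
  "ftrue = Or (Atom 0) (Neg (Atom 0))"

definition fand :: "nform \<Rightarrow> nform \<Rightarrow> nform" where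
  "fand f g = Neg (Or (Neg f) (Neg g))"

definition fdisj :: "nform list \<Rightarrow> nform" where
  "fdisj fs = foldr Or fs (Neg ftrue)"

definition fconj :: "nform list \<Rightarrow> nform" where
  "fconj fs = foldr fand fs ftrue"

lemma sem_ftrue [simp]: "sem_n N ftrue i"
  by (auto simp: ftrue_def)

lemma sem_fand [simp]: "sem_n N (fand f g) i \<longleftrightarrow> sem_n N f i \<and> sem_n N g i"
  by (simp add: fand_def)

lemma sem_fdisj [simp]: "sem_n N (fdisj fs) i \<longleftrightarrow> (\<exists>f\<in>set fs. sem_n N f i)"
  unfolding fdisj_def by (induction fs) auto

lemma sem_fconj [simp]: "sem_n N (fconj fs) i \<longleftrightarrow> (\<forall>f\<in>set fs. sem_n N f i)"
  unfolding fconj_def by (induction fs) auto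

lemma mem_sem_p [simp]:
  "(i, j) \<in> sem_p N (Test f) \<longleftrightarrow> i = j \<and> i < length (fst N) \<and> sem_n N f i"
  "(i, j) \<in> sem_p N Next \<longleftrightarrow> j = Suc i \<and> Suc i < length (fst N)"
  "(i, j) \<in> sem_p N Nest1 \<longleftrightarrow> (i, j) \<in> fst (snd N)"
  "(i, j) \<in> sem_p N Nest1inv \<longleftrightarrow> (j, i) \<in> fst (snd N)"
  "(i, j) \<in> sem_p N (Seq p q) \<longleftrightarrow> (\<exists>k. (i, k) \<in> sem_p N p \<and> (k, j) \<in> sem_p N q)"
  "(i, j) \<in> sem_p N (Star p) \<longleftrightarrow> i = j \<and> i < length (fst N) \<or> (i, j) \<in> (sem_p N p)\<^sup>+"
  by auto

declare sem_p.simps [simp del]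

text \<open>Letters below 5 open a row, 5 is a filler, and \<open>6 + a\<close> labels a cell whose set of registers
  is coded by \<open>a\<close>. The opening letter 0 is used for the rows of the simulated program; the letters
  1 to 4 announce the assignments that prepare its input.\<close>

definition row_opening :: nform where
  "row_opening = fdisj (map Atom [0..<5])"

definition within_row :: pform where
  "within_row = Star (Seq Next (Test (Neg row_opening)))"

definition to_next :: pform where
  "to_next = Seq within_row (Seq Next (Test row_opening))"

definition into_next :: pform where
  "into_next = Seq to_next within_row"

text \<open>The last conjunct excludes letters of this form at positions that pop nothing, which
  occur in arbitrary nested words.\<close>

definition marked :: "nat \<Rightarrow> nat \<Rightarrow> nform" where
  "marked R x = fand
     (fdisj (map (\<lambda>a. Atom (6 + a)) (filter (\<lambda>a. x \<in> set_decode a) [0..<2 ^ R])))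
     (Diam Nest1inv ftrue)"

text \<open>Two cells lie in the same column if they pop the same occurrence of a stack symbol. The loops
  compare a cell with the cell of its column in the following, or preceding, row.\<close>

definition same_column :: pform where
  "same_column = Seq Nest1inv Nest1"

definition marked_after :: "nat \<Rightarrow> nat \<Rightarrow> nform" where
  "marked_after R x = Loop (Seq into_next (Seq (Test (marked R x)) same_column))"

definition marked_before :: "nat \<Rightarrow> nat \<Rightarrow> nform" where
  "marked_before R x = Loop (Seq same_column (Seq (Test (marked R x)) into_next))"

definition sub_next :: "nat \<Rightarrow> nat \<Rightarrow> nat \<Rightarrow> nform" where
  "sub_next R x y = Neg (Diam within_row (fand (marked R x) (Neg (marked_after R y))))"

definition fresh_mark :: "nat \<Rightarrow> nat \<Rightarrow> nat \<Rightarrow> nform" where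
  "fresh_mark R x y = fand (marked R y) (Neg (marked_before R x))"

text \<open>Two inclusions, each tested from the cells of the row that is to be included. A push may
  lack a cell in the other row, so neither test could start there.\<close>

definition eq_next :: "nat \<Rightarrow> nat \<Rightarrow> nat \<Rightarrow> nform" where
  "eq_next R x y = fand (sub_next R x y) (Neg (Diam into_next (fresh_mark R x y)))"

text \<open>For \<open>Succ\<close>, a second fresh cell is excluded by the order of the row: the
  path with the leading \<open>Next\<close> reaches exactly the later positions of the same
  row.\<close>

fun becomes :: "nat \<Rightarrow> expr \<Rightarrow> nat \<Rightarrow> nform" where
  "becomes R Zero y = Neg (Diam into_next (marked R y))"
| "becomes R (Val x) y = eq_next R x y"
| "becomes R (Succ x) y = fand (sub_next R x y)
     (fand (Diam into_next (fresh_mark R x y))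
       (Neg (Diam into_next (fand (fresh_mark R x y)
          (Diam (Seq (Seq Next (Test (Neg row_opening))) within_row) (fresh_mark R x y))))))"

definition assigns :: "nat \<Rightarrow> nat \<Rightarrow> expr \<Rightarrow> nform" where
  "assigns R r e = fand (becomes R e r)
     (fconj (map (\<lambda>y. eq_next R y y) (filter (\<lambda>y. y \<noteq> r) [0..<R])))"

fun path_of :: "nat \<Rightarrow> prog \<Rightarrow> pform" where
  "path_of R (Assign r e) = Seq (Test (assigns R r e)) to_next"
| "path_of R (IfEq x y) = Test (fand
     (Neg (Diam within_row (fand (marked R x) (Neg (marked R y)))))
     (Neg (Diam within_row (fand (marked R y) (Neg (marked R x))))))"
| "path_of R (IfZero x) = Test (Neg (Diam within_row (marked R x)))"
| "path_of R (IfPos x) = Test (Diam within_row (marked R x))"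
| "path_of R (Then p q) = Seq (path_of R p) (path_of R q)"
| "path_of R (Iter p) = Star (path_of R p)"

section \<open>Rows and register contents of an arbitrary nested word\<close>

definition opens :: "nw \<Rightarrow> nat \<Rightarrow> bool" where
  "opens N i \<longleftrightarrow> i < length (fst N) \<and> fst N ! i < 5"

definition in_row :: "nw \<Rightarrow> nat \<Rightarrow> nat \<Rightarrow> bool" where
  "in_row N s j \<longleftrightarrow> s \<le> j \<and> j < length (fst N) \<and> (\<forall>i. s < i \<and> i \<le> j \<longrightarrow> \<not> opens N i)"

definition next_row :: "nw \<Rightarrow> nat \<Rightarrow> nat \<Rightarrow> bool" where
  "next_row N s t \<longleftrightarrow> s < t \<and> opens N t \<and> (\<forall>i. s < i \<and> i < t \<longrightarrow> \<not> opens N i)"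

definition mark :: "nat \<Rightarrow> nw \<Rightarrow> nat \<Rightarrow> nat \<Rightarrow> bool" where
  "mark R N x j \<longleftrightarrow> j < length (fst N) \<and> (\<exists>a<2 ^ R. fst N ! j = 6 + a \<and> x \<in> set_decode a)"

text \<open>Pushes are common to all rows, so these sets can be compared between rows, and several
  cells of one push count once.\<close>

definition regset :: "nat \<Rightarrow> nw \<Rightarrow> nat \<Rightarrow> nat \<Rightarrow> nat set" where
  "regset R N s x = {p. \<exists>j. in_row N s j \<and> mark R N x j \<and> (p, j) \<in> fst (snd N)}"

definition contents :: "nat \<Rightarrow> nw \<Rightarrow> nat \<Rightarrow> store" where
  "contents R N s x = card (regset R N s x)"

lemma sem_row_opening [simp]: "sem_n N row_opening i \<longleftrightarrow> opens N i"
  by (auto simp: row_opening_def opens_def)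

lemma mem_within_row [simp]: "(s, j) \<in> sem_p N within_row \<longleftrightarrow> in_row N s j"
proof -
  let ?X = "sem_p N (Seq Next (Test (Neg row_opening)))"
  have X: "(i, k) \<in> ?X \<longleftrightarrow> k = Suc i \<and> k < length (fst N) \<and> \<not> opens N k" for i k
    by auto
  have "in_row N s j \<and> s < j" if "(s, j) \<in> ?X\<^sup>+"
    using that
  proof induction
    case (base k)
    then show ?case unfolding X in_row_def by (auto simp: le_Suc_eq)
  next
    case (step k l)
    then show ?case unfolding X in_row_def by (auto simp: le_Suc_eq)
  qed
  moreover have "(s, j) \<in> ?X\<^sup>+" if "s < j" "in_row N s j"
    using that
  proof (induction j)
    case (Suc k)
    then have "(k, Suc k) \<in> ?X" unfolding X in_row_def by simp
    moreover have "(s, k) \<in> ?X\<^sup>+" if "s \<noteq> k"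
      using Suc that unfolding in_row_def by simp
    ultimately show ?case by (cases "s = k") (auto intro: trancl_into_trancl)
  qed simp
  moreover have "in_row N s j \<longleftrightarrow> s < length (fst N)" if "s = j"
    using that by (auto simp: in_row_def)
  moreover have "s = j \<or> s < j" if "in_row N s j"
    using that by (auto simp: in_row_def)
  ultimately show ?thesis
    unfolding within_row_def mem_sem_p(6) by blast
qed

lemma mem_to_next [simp]: "(s, t) \<in> sem_p N to_next \<longleftrightarrow> next_row N s t"
proof
  assume "(s, t) \<in> sem_p N to_next"
  then show "next_row N s t"
    by (auto simp: to_next_def next_row_def in_row_def less_Suc_eq_le)
next
  assume t: "next_row N s t"
  then have "in_row N s (t - 1)"
    by (auto simp: next_row_def in_row_def opens_def)
  moreover have "Suc (t - 1) = t" using t by (auto simp: next_row_def)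
  ultimately show "(s, t) \<in> sem_p N to_next"
    using t unfolding to_next_def mem_sem_p mem_within_row
    by (intro exI[of _ "t - 1"] conjI exI[of _ t]) (auto simp: next_row_def opens_def)
qed

lemma mem_into_next [simp]:
  "(s, j) \<in> sem_p N into_next \<longleftrightarrow> (\<exists>t. next_row N s t \<and> in_row N t j)"
  by (simp add: into_next_def)

lemma sem_marked [simp]:
  "sem_n N (marked R x) j \<longleftrightarrow> mark R N x j \<and> (\<exists>p. (p, j) \<in> fst (snd N))"
  by (auto simp: marked_def mark_def)

text \<open>Read at any cell, \<open>to_next\<close> leads to the row after the one that contains
  the cell; so the loops can start inside a row.\<close>

lemma next_row_from:
  assumes "next_row N s t" "in_row N s j"
  shows "next_row N j u \<longleftrightarrow> u = t"
proof -
  have "j < t" using assms unfolding next_row_def in_row_def by (metis not_less)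
  then have "next_row N j t" using assms unfolding next_row_def in_row_def by auto
  moreover have "u = t" if "next_row N j u"
    using that \<open>next_row N j t\<close> unfolding next_row_def by (metis linorder_neqE_nat)
  ultimately show ?thesis by blast
qed

lemma in_row_unique:
  assumes "in_row N s j" "in_row N t j" "opens N s" "opens N t"
  shows "s = t"
  using assms unfolding in_row_def by (metis linorder_neqE_nat)

lemma in_row_before:
  assumes "opens N s" "next_row N s t" "next_row N j t"
  shows "in_row N s j"
  using assms unfolding next_row_def in_row_def
  by (smt (verit) dual_order.strict_trans le_less_trans linorder_not_less opens_def)

text \<open>Registers from \<open>R\<close> on are empty in all rows, so the finitely many conjuncts
  of \<open>assigns\<close> determine the whole store.\<close>

lemma regset_beyond:
  assumes "R \<le> x" shows "regset R N s x = {}"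
proof -
  have "x \<notin> set_decode a" if "a < 2 ^ R" for a
  proof -
    have "a < 2 ^ x" using that power_increasing[OF assms, of "2::nat"] by linarith
    then show ?thesis by (simp add: set_decode_def)
  qed
  then show ?thesis by (auto simp: regset_def mark_def)
qed

section \<open>Soundness of the formulas\<close>

locale functional_nesting =
  fixes N :: nw and R :: nat
  assumes source_unique: "(p, j) \<in> fst (snd N) \<Longrightarrow> (q, j) \<in> fst (snd N) \<Longrightarrow> p = q"
begin

lemma finite_regset: "finite (regset R N s x)"
proof -
  have "regset R N s x \<subseteq> (\<lambda>j. THE p. (p, j) \<in> fst (snd N)) ` {..<length (fst N)}"
  proof
    fix p assume "p \<in> regset R N s x"
    then obtain j where j: "j < length (fst N)" "(p, j) \<in> fst (snd N)"
      by (auto simp: regset_def in_row_def)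
    then have "(THE p. (p, j) \<in> fst (snd N)) = p"
      using source_unique by blast
    with j(1) show "p \<in> (\<lambda>j. THE p. (p, j) \<in> fst (snd N)) ` {..<length (fst N)}"
      by force
  qed
  then show ?thesis by (rule finite_subset) simp
qed

context
  fixes s t
  assumes s: "opens N s" and t: "next_row N s t"
begin

text \<open>\<open>same_column\<close> must return to \<open>j\<close>, so \<open>j\<close> and the
  cell found in row \<open>t\<close> have a common push, and the only push of \<open>j\<close> is
  \<open>p\<close>.\<close>

lemma sem_marked_after:
  assumes "in_row N s j" "(p, j) \<in> fst (snd N)"
  shows "sem_n N (marked_after R x) j \<longleftrightarrow> p \<in> regset R N t x"
proof -
  have "sem_n N (marked_after R x) j \<longleftrightarrow>
      (\<exists>k q. in_row N t k \<and> mark R N x k \<and> (q, k) \<in> fst (snd N) \<and> (q, j) \<in> fst (snd N))"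
    using next_row_from[OF t assms(1)]
    by (auto simp: marked_after_def same_column_def in_row_def)
  moreover have "(q, j) \<in> fst (snd N) \<longleftrightarrow> q = p" for q
    using assms(2) source_unique by blast
  ultimately show ?thesis unfolding regset_def by simp
qed

text \<open>The path first leaves \<open>j\<close> for any cell of the column, possibly in a distant
  row; that \<open>into_next\<close> ends at \<open>j\<close> again forces this cell into row
  \<open>s\<close>.\<close>

lemma sem_marked_before:
  assumes "in_row N t j" "(p, j) \<in> fst (snd N)"
  shows "sem_n N (marked_before R x) j \<longleftrightarrow> p \<in> regset R N s x"
proof -
  have "next_row N k u \<and> in_row N u j \<longleftrightarrow> u = t \<and> in_row N s k" for k u
    using in_row_unique[OF _ assms(1)] in_row_before[OF s t] next_row_from[OF t] t assms(1)
    by (metis next_row_def)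
  then have "sem_n N (marked_before R x) j \<longleftrightarrow>
      (\<exists>k q. in_row N s k \<and> mark R N x k \<and> (q, k) \<in> fst (snd N) \<and> (q, j) \<in> fst (snd N))"
    by (auto simp: marked_before_def same_column_def in_row_def)
  moreover have "(q, j) \<in> fst (snd N) \<longleftrightarrow> q = p" for q
    using assms(2) source_unique by blast
  ultimately show ?thesis unfolding regset_def by simp
qed

lemma next_row_iff: "next_row N s u \<longleftrightarrow> u = t"
  using next_row_from[OF t, of s] s by (auto simp: in_row_def opens_def)

lemma sem_sub_next: "sem_n N (sub_next R x y) s \<longleftrightarrow> regset R N s x \<subseteq> regset R N t y"
proof -
  have "sem_n N (sub_next R x y) s \<longleftrightarrow>
      (\<forall>j p. in_row N s j \<and> mark R N x j \<and> (p, j) \<in> fst (snd N) \<longrightarrow> sem_n N (marked_after R y) j)"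
    by (auto simp: sub_next_def)
  also have "\<dots> \<longleftrightarrow> regset R N s x \<subseteq> regset R N t y"
    using sem_marked_after by (auto simp: regset_def[of R N s])
  finally show ?thesis .
qed

lemma sem_fresh_mark:
  assumes "in_row N t j"
  shows "sem_n N (fresh_mark R x y) j \<longleftrightarrow>
    (\<exists>p. mark R N y j \<and> (p, j) \<in> fst (snd N) \<and> p \<notin> regset R N s x)"
  using sem_marked_before[OF assms] by (auto simp: fresh_mark_def)

lemma ex_fresh_mark:
  "sem_n N (Diam into_next (fresh_mark R x y)) s \<longleftrightarrow> \<not> regset R N t y \<subseteq> regset R N s x"
proof -
  have "sem_n N (Diam into_next (fresh_mark R x y)) s \<longleftrightarrow>
      (\<exists>j. in_row N t j \<and> sem_n N (fresh_mark R x y) j)"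
    by (auto simp: next_row_iff)
  also have "\<dots> \<longleftrightarrow> \<not> regset R N t y \<subseteq> regset R N s x"
    using sem_fresh_mark unfolding regset_def[of R N t] by blast
  finally show ?thesis .
qed

lemma sem_eq_next: "sem_n N (eq_next R x y) s \<longleftrightarrow> regset R N s x = regset R N t y"
  using sem_sub_next ex_fresh_mark by (auto simp: eq_next_def simp del: sem_n.simps(4))

lemma sem_becomes_Zero: "sem_n N (becomes R Zero y) s \<longleftrightarrow> regset R N t y = {}"
  by (auto simp: next_row_iff regset_def)

lemma sem_becomes_Succ:
  "sem_n N (becomes R (Succ x) y) s \<longleftrightarrow> regset R N s x \<subseteq> regset R N t y \<and>
     (\<exists>!j. in_row N t j \<and> sem_n N (fresh_mark R x y) j)"
proof -
  have nx: "(i, j) \<in> sem_p N (Seq (Seq Next (Test (Neg row_opening))) within_row) \<longleftrightarrow> i < j \<and> in_row N i j"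
    for i j
  proof -
    have "in_row N i j \<and> i < j \<longleftrightarrow> \<not> opens N (Suc i) \<and> Suc i < length (fst N) \<and> in_row N (Suc i) j"
      unfolding in_row_def by (metis Suc_leI Suc_lessI Suc_le_lessD le_less_trans lessI less_imp_le)
    then show ?thesis by auto
  qed
  have 1: "sem_n N (Diam into_next (fresh_mark R x y)) s \<longleftrightarrow>
      (\<exists>j. in_row N t j \<and> sem_n N (fresh_mark R x y) j)"
    by (auto simp: next_row_iff)
  have row: "in_row N i j \<longleftrightarrow> in_row N t j" if "in_row N t i" "i < j" for i j
    using that unfolding in_row_def by (meson leD le_less_linear less_imp_le order.strict_trans order_trans)
  have 2: "sem_n N (Neg (Diam into_next (fand (fresh_mark R x y)
          (Diam (Seq (Seq Next (Test (Neg row_opening))) within_row) (fresh_mark R x y))))) s \<longleftrightarrow>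
      (\<forall>i j. in_row N t i \<and> in_row N t j \<and> i < j \<longrightarrow>
         \<not> (sem_n N (fresh_mark R x y) i \<and> sem_n N (fresh_mark R x y) j))"
    unfolding sem_n.simps(3,4) sem_fand nx mem_into_next using row by (auto simp: next_row_iff)
  have 3: "(\<exists>j. A j) \<and> (\<forall>i j. A i \<and> A j \<and> i < j \<longrightarrow> False) \<longleftrightarrow> (\<exists>!j. A j)" for A :: "nat \<Rightarrow> bool"
    by (metis linorder_neqE_nat less_irrefl)
  show ?thesis
    unfolding becomes.simps sem_fand sem_sub_next 1 2
    using 3[of "\<lambda>j. in_row N t j \<and> sem_n N (fresh_mark R x y) j"] by blast
qed

text \<open>Uniqueness passes from cells to pushes because a cell has only one push: two new pushes
  would have two different fresh cells.\<close>

lemma becomes_Succ_sound: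
  assumes "sem_n N (becomes R (Succ x) y) s"
  shows "\<exists>p. p \<notin> regset R N s x \<and> regset R N t y = insert p (regset R N s x)"
proof -
  from assms have sub: "regset R N s x \<subseteq> regset R N t y"
    and ex1: "\<exists>!j. in_row N t j \<and> sem_n N (fresh_mark R x y) j"
    by (simp_all only: sem_becomes_Succ)
  from ex1 obtain j where j: "in_row N t j" "sem_n N (fresh_mark R x y) j"
    and uniq: "\<And>k. in_row N t k \<Longrightarrow> sem_n N (fresh_mark R x y) k \<Longrightarrow> k = j" by blast
  from j obtain p where p: "mark R N y j" "(p, j) \<in> fst (snd N)" "p \<notin> regset R N s x"
    using sem_fresh_mark by blast
  have "q = p" if q: "q \<in> regset R N t y" "q \<notin> regset R N s x" for q
  proof -
    from q(1) obtain k where k: "in_row N t k" "mark R N y k" "(q, k) \<in> fst (snd N)"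
      by (auto simp: regset_def)
    then have "k = j" using uniq q(2) sem_fresh_mark by blast
    with k p show ?thesis using source_unique by blast
  qed
  moreover have "p \<in> regset R N t y" using p j by (auto simp: regset_def)
  ultimately show ?thesis using sub p(3) by blast
qed

text \<open>Here uniqueness has to pass from pushes to cells. In an arbitrary nested word a push may
  be popped several times within a row, hence the hypothesis \<open>inj\<close>.\<close>

lemma becomes_Succ_complete:
  assumes "p \<notin> regset R N s x" "regset R N t y = insert p (regset R N s x)"
    and inj: "\<And>j k q. in_row N t j \<Longrightarrow> in_row N t k \<Longrightarrow> (q, j) \<in> fst (snd N) \<Longrightarrow> (q, k) \<in> fst (snd N) \<Longrightarrow> j = k"
  shows "sem_n N (becomes R (Succ x) y) s"
proof -
  have p: "mark R N y j \<and> (q, j) \<in> fst (snd N) \<and> q \<notin> regset R N s x \<longrightarrow> q = p" if "in_row N t j" for j q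
    using that assms(2) by (auto simp: regset_def[of R N t])
  obtain j where j: "in_row N t j" "mark R N y j" "(p, j) \<in> fst (snd N)"
    using assms(2) by (auto simp: regset_def[of R N t])
  have "\<exists>!j. in_row N t j \<and> sem_n N (fresh_mark R x y) j"
  proof (rule ex1I[of _ j])
    show "in_row N t j \<and> sem_n N (fresh_mark R x y) j"
      using j sem_fresh_mark assms(1) by blast
    fix k assume "in_row N t k \<and> sem_n N (fresh_mark R x y) k"
    then show "k = j" using p sem_fresh_mark inj j by blast
  qed
  then show ?thesis using assms(2) by (simp only: sem_becomes_Succ) blast
qed

lemma assigns_sound:
  assumes "sem_n N (assigns R r e) s"
  shows "contents R N t = (contents R N s)(r := eval_expr e (contents R N s))"
proof
  from assms have e: "sem_n N (becomes R e r) s"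
    and others: "\<And>y. y < R \<Longrightarrow> y \<noteq> r \<Longrightarrow> sem_n N (eq_next R y y) s"
    by (auto simp: assigns_def)
  fix y
  show "contents R N t y = ((contents R N s)(r := eval_expr e (contents R N s))) y"
  proof (cases "y = r")
    case True
    have "contents R N t r = eval_expr e (contents R N s)"
    proof (cases e)
      case Zero
      then show ?thesis using e sem_becomes_Zero by (simp add: contents_def del: becomes.simps)
    next
      case (Val x)
      then show ?thesis using e sem_eq_next by (simp add: contents_def)
    next
      case (Succ x)
      then obtain p where "p \<notin> regset R N s x" "regset R N t r = insert p (regset R N s x)"
        using becomes_Succ_sound e by blast
      then show ?thesis using Succ by (simp add: contents_def finite_regset)
    qed
    with True show ?thesis by simp
  next
    case False
    then show ?thesis
      using others[of y] sem_eq_next regset_beyond[of R y]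
      by (cases "y < R") (simp_all add: contents_def)
  qed
qed

end

text \<open>Tests stay and assignments go from one opening to the next, so a path from an opening
  visits only openings between its steps, and \<open>contents\<close> maps it to a run.\<close>

lemma path_of_sound:
  "(s, t) \<in> sem_p N (path_of R p) \<Longrightarrow> opens N s \<Longrightarrow>
     opens N t \<and> (contents R N s, contents R N t) \<in> psem p"
proof (induction p arbitrary: s t)
  case (Assign r e)
  then have "sem_n N (assigns R r e) s" "next_row N s t"
    by auto
  then show ?case using assigns_sound[OF Assign.prems(2)] by (auto simp: next_row_def)
next
  case (IfEq x y)
  then have "s = t" and
    "\<And>j q. in_row N s j \<Longrightarrow> (q, j) \<in> fst (snd N) \<Longrightarrow> mark R N x j \<longleftrightarrow> mark R N y j"
    by auto
  then show ?case using IfEq.prems(2) unfolding contents_def regset_def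
    by (auto intro!: arg_cong[where f = card])
next
  case (IfZero x)
  then have "s = t" "regset R N s x = {}"
    by (auto simp: regset_def)
  then show ?case using IfZero.prems(2) by (simp add: contents_def)
next
  case (IfPos x)
  then have "s = t" "regset R N s x \<noteq> {}"
    by (auto simp: regset_def)
  then show ?case using IfPos.prems(2) by (simp add: contents_def finite_regset card_gt_0_iff)
next
  case (Then p q)
  then show ?case by fastforce
next
  case (Iter p)
  then consider "s = t" | "(s, t) \<in> (sem_p N (path_of R p))\<^sup>+" by auto
  then show ?case
  proof cases
    case 1
    then show ?thesis using Iter.prems by simp
  next
    case 2
    then have "opens N t \<and> (contents R N s, contents R N t) \<in> (psem p)\<^sup>*"
    proof induction
      case (base u)
      then show ?case using Iter.IH Iter.prems(2) by blast
    next
      case (step u v)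
      then show ?case using Iter.IH by (meson rtrancl_into_rtrancl)
    qed
    then show ?thesis by simp
  qed
qed

end

section \<open>Completeness on words that store values in initial columns\<close>

locale rows = functional_nesting +
  fixes pos :: "nat \<Rightarrow> nat" and L :: "store list"
  assumes opens_pos: "i < length L \<Longrightarrow> opens N (pos i)"
    and next_pos: "Suc i < length L \<Longrightarrow> next_row N (pos i) (pos (Suc i))"
    and regset_pos: "i < length L \<Longrightarrow> x < R \<Longrightarrow> regset R N (pos i) x = {..<(L ! i) x}"
    and column_unique: "i < length L \<Longrightarrow> in_row N (pos i) j \<Longrightarrow> in_row N (pos i) k \<Longrightarrow>
      (q, j) \<in> fst (snd N) \<Longrightarrow> (q, k) \<in> fst (snd N) \<Longrightarrow> j = k"
begin

lemma assigns_complete: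
  assumes i: "Suc i < length L" and step: "L ! Suc i = (L ! i)(r := eval_expr e (L ! i))"
    and r: "r < R" and e: "regs_expr e \<le> R"
  shows "sem_n N (assigns R r e) (pos i)"
proof -
  have s: "opens N (pos i)" and t: "next_row N (pos i) (pos (Suc i))"
    using opens_pos next_pos i by auto
  note set = regset_pos[of i] regset_pos[of "Suc i"]
  have "sem_n N (eq_next R y y) (pos i)" if "y < R" "y \<noteq> r" for y
    using that i set by (simp add: sem_eq_next[OF s t] step)
  moreover have "sem_n N (becomes R e r) (pos i)"
  proof (cases e)
    case Zero
    then show ?thesis using i set r step by (simp add: sem_becomes_Zero[OF s t] del: becomes.simps)
  next
    case (Val x)
    then show ?thesis using i set r step e by (simp add: sem_eq_next[OF s t])
  next
    case (Succ x)
    have "sem_n N (becomes R (Succ x) r) (pos i)"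
    \<comment> \<open>A value \<open>v\<close> occupies the columns of the pushes below
      \<open>v\<close>, so the successor adds the column of push \<open>v\<close>.\<close>
    proof (rule becomes_Succ_complete[OF s t, of "(L ! i) x"])
      show "(L ! i) x \<notin> regset R N (pos i) x" using Succ i set e by simp
      show "regset R N (pos (Suc i)) r = insert ((L ! i) x) (regset R N (pos i) x)"
        using Succ i set e step r by (auto simp: less_Suc_eq)
    qed (use column_unique i in blast)
    with Succ show ?thesis by simp
  qed
  ultimately show ?thesis by (auto simp: assigns_def)
qed

lemma pos_less: "i < length L \<Longrightarrow> pos i < length (fst N)"
  using opens_pos by (auto simp: opens_def)

lemma marked_iff:
  assumes "i < length L" "in_row N (pos i) j" "(p, j) \<in> fst (snd N)" "x < R"
  shows "mark R N x j \<longleftrightarrow> p < (L ! i) x"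
proof -
  have "mark R N x j \<longleftrightarrow> p \<in> regset R N (pos i) x"
    using assms column_unique by (auto simp: regset_def)
  then show ?thesis using regset_pos assms by auto
qed

lemma path_of_complete:
  "(i, j) \<in> along L p \<Longrightarrow> regs p \<le> R \<Longrightarrow> (pos i, pos j) \<in> sem_p N (path_of R p)"
proof (induction p arbitrary: i j)
  case (Assign r e)
  then show ?case
    using assigns_complete[of i r e] next_pos[of i] pos_less[of i] by auto
next
  case (IfEq x y)
  then have "j = i" "i < length L" "(L ! i) x = (L ! i) y" "x < R" "y < R" by auto
  then show ?case
    using marked_iff pos_less by auto
next
  case (IfZero x)
  then have "j = i" "i < length L" "(L ! i) x = 0" "x < R" by auto
  then show ?case
    using marked_iff pos_less by auto
next
  case (IfPos x)
  then have *: "j = i" "i < length L" "(L ! i) x > 0" "x < R" by auto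
  then have "0 \<in> regset R N (pos i) x" using regset_pos by simp
  then show ?case
    using * pos_less by (auto simp: regset_def)
next
  case (Then p q)
  then obtain k where "(i, k) \<in> along L p" "(k, j) \<in> along L q" by auto
  then have "(pos i, pos k) \<in> sem_p N (path_of R p)" "(pos k, pos j) \<in> sem_p N (path_of R q)"
    using Then.IH Then.prems(2) by auto
  then show ?case by auto
next
  case (Iter p)
  then consider "i = j" "i < length L" | "(i, j) \<in> (along L p)\<^sup>+" by auto
  then show ?case
  proof cases
    case 1
    then show ?thesis using pos_less by auto
  next
    case 2
    then have "(pos i, pos j) \<in> (sem_p N (path_of R p))\<^sup>+"
    proof induction
      case (base k)
      then show ?case using Iter.IH Iter.prems(2) by auto
    next
      case (step k l)
      then show ?case using Iter.IH[of k l] Iter.prems(2) by (auto intro: trancl_into_trancl)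
    qed
    then show ?thesis by simp
  qed
qed

end

section \<open>Feeding the input through announced assignments\<close>

definition announced :: "nat \<Rightarrow> pform" where
  "announced a = Seq (Test (Atom a)) to_next"

text \<open>The diamonds only read off the announcing letters. That the announced assignments are carried
  out depends on the number of registers and is left to \<open>\<phi>\<close>.\<close>

definition input_sentence :: "nform \<Rightarrow> nat \<Rightarrow> nat \<Rightarrow> sentence" where
  "input_sentence \<phi> x y =
     E (Diam (announced 1) (Diam (announced 2)
        ((Diam (announced 3) ^^ x) ((Diam (announced 4) ^^ y) \<phi>))))"

definition announcements :: "(nat \<times> nat \<times> expr) list" where
  "announcements = [(1, 0, Zero), (2, 1, Zero), (3, 0, Succ 0), (4, 1, Succ 1)]"

text \<open>Evaluated at the end of the announcing rows, where \<open>Star Prev\<close> sees every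
  earlier position. An announcing letter there has to be obeyed whether or not it belongs to the
  chain of diamonds.\<close>

definition run_formula :: "nat \<Rightarrow> prog \<Rightarrow> nform" where
  "run_formula R p = fand
     (fconj (map (\<lambda>(a, r, e). Neg (Diam (Star Prev) (fand (Atom a) (Neg (assigns R r e))))) announcements))
     (Diam (path_of R p) ftrue)"

lemma mem_announced [simp]:
  "(s, t) \<in> sem_p N (announced a) \<longleftrightarrow> s < length (fst N) \<and> fst N ! s = a \<and> next_row N s t"
  by (auto simp: announced_def)

lemma star_prev: "j \<le> i \<Longrightarrow> i < length (fst N) \<Longrightarrow> (i, j) \<in> sem_p N (Star Prev)"
proof (induction i)
  case (Suc i)
  have prev: "(Suc i, i) \<in> sem_p N Prev" using Suc.prems by (simp add: sem_p.simps)
  show ?case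
  proof (cases "j = Suc i")
    case False
    then have "(i, j) \<in> sem_p N (Star Prev)" using Suc by simp
    then show ?thesis using prev by (auto intro: trancl_into_trancl2)
  qed (use Suc.prems in simp)
qed simp

lemma funpow_incr: "((\<lambda>\<sigma>. \<sigma>(r := eval_expr (Succ r) \<sigma>)) ^^ n) \<sigma> = \<sigma>(r := \<sigma> r + n)"
  by (induction n) auto

context functional_nesting
begin

text \<open>Whether the announcements are obeyed is known only at the far end of the chain, where
  the innermost formula is evaluated. The claim about the stores is therefore an implication, with a
  premise about positions up to \<open>t\<close> only, so that one final check discharges it for all
  four letters.\<close>

lemma announced_pow_sound:
  "sem_n N ((Diam (announced a) ^^ n) \<phi>) s \<Longrightarrow> opens N s \<Longrightarrow>
   \<exists>t\<ge>s. opens N t \<and> sem_n N \<phi> t \<and>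
     ((\<forall>q\<le>t. fst N ! q = a \<longrightarrow> sem_n N (assigns R r e) q) \<longrightarrow>
      contents R N t = ((\<lambda>\<sigma>. \<sigma>(r := eval_expr e \<sigma>)) ^^ n) (contents R N s))"
proof (induction n arbitrary: s)
  case (Suc n)
  then obtain u where u: "fst N ! s = a" "next_row N s u"
    and "sem_n N ((Diam (announced a) ^^ n) \<phi>) u" by auto
  moreover have "opens N u" "s < u" using u(2) by (auto simp: next_row_def)
  ultimately obtain t where t: "t \<ge> u" "opens N t" "sem_n N \<phi> t"
    "(\<forall>q\<le>t. fst N ! q = a \<longrightarrow> sem_n N (assigns R r e) q) \<longrightarrow>
      contents R N t = ((\<lambda>\<sigma>. \<sigma>(r := eval_expr e \<sigma>)) ^^ n) (contents R N u)"
    using Suc.IH by blast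
  have "contents R N t = ((\<lambda>\<sigma>. \<sigma>(r := eval_expr e \<sigma>)) ^^ Suc n) (contents R N s)"
    if ann: "\<forall>q\<le>t. fst N ! q = a \<longrightarrow> sem_n N (assigns R r e) q"
  proof -
    have "sem_n N (assigns R r e) s" using ann u(1) t(1) \<open>s < u\<close> by simp
    from assigns_sound[OF Suc.prems(2) u(2) this] show ?thesis
      using t(4) ann by (simp add: funpow_Suc_right del: funpow.simps)
  qed
  moreover have "s \<le> t" using t(1) \<open>s < u\<close> by simp
  ultimately show ?case using t(2,3) by blast
qed auto

text \<open>The first row may contain anything; the announcements 1 and 2 reset the two input
  registers. Nothing is claimed about the others, since compiled programs are correct for any
  initial contents of them.\<close>

lemma input_sentence_sound:
  assumes "models N (input_sentence (run_formula R p) x y)"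
  shows "\<exists>\<sigma> \<tau>. (\<sigma>, \<tau>) \<in> psem p \<and> \<sigma> 0 = x \<and> \<sigma> 1 = y"
proof -
  define F4 where "F4 = (Diam (announced 4) ^^ y) (run_formula R p)"
  define F3 where "F3 = (Diam (announced 3) ^^ x) F4"
  \<comment> \<open>A single diamond is written as a power so that
    \<open>announced_pow_sound\<close> applies to all four letters.\<close>
  define F2 where "F2 = (Diam (announced 2) ^^ 1) F3"
  obtain s where s: "s < length (fst N)" "sem_n N ((Diam (announced 1) ^^ 1) F2) s"
    using assms by (auto simp: input_sentence_def F2_def F3_def F4_def)
  from s(2) have "opens N s" using s(1) by (auto simp: opens_def)
  from announced_pow_sound[OF s(2) this, of 0 Zero]
  obtain s1 where s1: "opens N s1" "sem_n N F2 s1"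
    "(\<forall>q\<le>s1. fst N ! q = 1 \<longrightarrow> sem_n N (assigns R 0 Zero) q) \<longrightarrow>
      contents R N s1 = ((\<lambda>\<sigma>. \<sigma>(0 := eval_expr Zero \<sigma>)) ^^ 1) (contents R N s)" by blast
  from announced_pow_sound[OF s1(2)[unfolded F2_def] s1(1), of 1 Zero]
  obtain s2 where s2: "s1 \<le> s2" "opens N s2" "sem_n N F3 s2"
    "(\<forall>q\<le>s2. fst N ! q = 2 \<longrightarrow> sem_n N (assigns R 1 Zero) q) \<longrightarrow>
      contents R N s2 = ((\<lambda>\<sigma>. \<sigma>(1 := eval_expr Zero \<sigma>)) ^^ 1) (contents R N s1)" by blast
  from announced_pow_sound[OF s2(3)[unfolded F3_def] s2(2), of 0 "Succ 0"]
  obtain s3 where s3: "s2 \<le> s3" "opens N s3" "sem_n N F4 s3"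
    "(\<forall>q\<le>s3. fst N ! q = 3 \<longrightarrow> sem_n N (assigns R 0 (Succ 0)) q) \<longrightarrow>
      contents R N s3 = (contents R N s2)(0 := contents R N s2 0 + x)"
    unfolding funpow_incr by blast
  from announced_pow_sound[OF s3(3)[unfolded F4_def] s3(2), of 1 "Succ 1"]
  obtain s4 where s4: "s3 \<le> s4" "opens N s4" "sem_n N (run_formula R p) s4"
    "(\<forall>q\<le>s4. fst N ! q = 4 \<longrightarrow> sem_n N (assigns R 1 (Succ 1)) q) \<longrightarrow>
      contents R N s4 = (contents R N s3)(1 := contents R N s3 1 + y)"
    unfolding funpow_incr by blast
  have obey: "sem_n N (assigns R r e) q" if "(a, r, e) \<in> set announcements" "q \<le> s4" "fst N ! q = a" for a r e q
  proof -
    have "(s4, q) \<in> sem_p N (Star Prev)" "q < length (fst N)"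
      using star_prev[OF that(2)] s4(2) that(2) by (auto simp: opens_def)
    moreover have "sem_n N (Neg (Diam (Star Prev) (fand (Atom a) (Neg (assigns R r e))))) s4"
      using s4(3) that(1) unfolding run_formula_def sem_fand sem_fconj by fastforce
    ultimately show ?thesis using that(3) unfolding sem_n.simps(3,4) sem_fand by auto
  qed
  have "contents R N s1 0 = 0" using s1(3) obey[of 1 0 Zero] s2(1) s3(1) s4(1)
    by (simp add: announcements_def)
  moreover have "contents R N s2 = (contents R N s1)(1 := 0)"
    using s2(4) obey[of 2 1 Zero] s3(1) s4(1) by (simp add: announcements_def)
  moreover have "contents R N s3 = (contents R N s2)(0 := contents R N s2 0 + x)"
    using s3(4) obey[of 3 0 "Succ 0"] s4(1) by (simp add: announcements_def)
  moreover have "contents R N s4 = (contents R N s3)(1 := contents R N s3 1 + y)"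
    using s4(4) obey[of 4 1 "Succ 1"] by (simp add: announcements_def)
  ultimately have "contents R N s4 0 = x" "contents R N s4 1 = y" by simp_all
  moreover obtain t where "(s4, t) \<in> sem_p N (path_of R p)"
    using s4(3) by (auto simp: run_formula_def)
  then have "(contents R N s4, contents R N t) \<in> psem p"
    using path_of_sound s4(2) by blast
  ultimately show ?thesis by blast
qed

end

context rows
begin

lemma announced_pow_complete:
  assumes "\<And>k. k < n \<Longrightarrow> fst N ! pos (i + k) = a" "i + n < length L" "sem_n N \<phi> (pos (i + n))"
  shows "sem_n N ((Diam (announced a) ^^ n) \<phi>) (pos i)"
  using assms
proof (induction n arbitrary: i)
  case (Suc n)
  have "sem_n N ((Diam (announced a) ^^ n) \<phi>) (pos (Suc i))"
    by (rule Suc.IH) (use Suc.prems in force)+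
  moreover have "fst N ! pos i = a" using Suc.prems(1)[of 0] by simp
  ultimately show ?case
    using next_pos[of i] pos_less[of i] Suc.prems(2) by auto
qed simp

lemma input_sentence_complete:
  assumes n: "2 + x + y < length L"
    and letters: "fst N ! pos 0 = 1" "fst N ! pos 1 = 2"
      "\<And>k. k < x \<Longrightarrow> fst N ! pos (2 + k) = 3"
      "\<And>k. k < y \<Longrightarrow> fst N ! pos (2 + x + k) = 4"
    and obey: "\<And>a r e q. (a, r, e) \<in> set announcements \<Longrightarrow> q < length (fst N) \<Longrightarrow>
      fst N ! q = a \<Longrightarrow> sem_n N (assigns R r e) q"
    and p: "(2 + x + y, j) \<in> along L p" "regs p \<le> R"
  shows "models N (input_sentence (run_formula R p) x y)"
proof -
  have run: "sem_n N (run_formula R p) (pos (2 + x + y))"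
    unfolding run_formula_def sem_fand sem_fconj
  proof (intro conjI ballI)
    show "sem_n N (Diam (path_of R p) ftrue) (pos (2 + x + y))"
      using path_of_complete[OF p] by auto
    fix f
    assume "f \<in> set (map (\<lambda>(a, r, e). Neg (Diam (Star Prev) (fand (Atom a) (Neg (assigns R r e))))) announcements)"
    then obtain a r e where "(a, r, e) \<in> set announcements"
      "f = Neg (Diam (Star Prev) (fand (Atom a) (Neg (assigns R r e))))" by auto
    then show "sem_n N f (pos (2 + x + y))" using obey[of a r e] by auto
  qed
  have count: "sem_n N ((Diam (announced 4) ^^ y) (run_formula R p)) (pos (2 + x))"
    by (rule announced_pow_complete[OF letters(4) n run])
  have "2 + x < length L" using n by simp
  from announced_pow_complete[OF letters(3) this count]
  have "sem_n N ((Diam (announced 3) ^^ x) ((Diam (announced 4) ^^ y) (run_formula R p))) (pos 2)" .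
  then have "sem_n N (Diam (announced 1) (Diam (announced 2)
      ((Diam (announced 3) ^^ x) ((Diam (announced 4) ^^ y) (run_formula R p))))) (pos 0)"
    using letters(1,2) next_pos[of 0] next_pos[of 1] pos_less[of 0] pos_less[of 1] n
    by (force simp: numeral_2_eq_2)
  then show ?thesis
    using pos_less[of 0] n unfolding input_sentence_def models.simps by auto
qed

end

subsection \<open>Grids as nested words\<close>

lemma step_nest1:
  "step j op st = Some (st', A, B) \<Longrightarrow> (\<forall>(p, k)\<in>A. k = j) \<and> (\<forall>p q k. (p, k) \<in> A \<longrightarrow> (q, k) \<in> A \<longrightarrow> p = q)"
  by (cases op) (auto split: if_splits simp: Let_def)

text \<open>A step creates at most one pair, ending at its own position; the bound
  \<open>j \<le> k\<close> in the claim keeps the pairs of later steps apart from it.\<close>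

lemma run_ops_nest1_unique:
  "run_ops j st ops = Some (st', A, B) \<Longrightarrow>
    (\<forall>(p, k)\<in>A. j \<le> k) \<and> (\<forall>p q k. (p, k) \<in> A \<longrightarrow> (q, k) \<in> A \<longrightarrow> p = q)"
proof (induction ops arbitrary: j st A B)
  case (Cons op ops)
  from Cons.prems obtain st1 A1 B1 A2 B2 where 1: "step j op st = Some (st1, A1, B1)"
    and 2: "run_ops (Suc j) st1 ops = Some (st', A2, B2)" and A: "A = A1 \<union> A2"
    by (auto split: option.splits prod.splits)
  have s: "\<And>p k. (p, k) \<in> A1 \<Longrightarrow> k = j" "\<And>p q k. (p, k) \<in> A1 \<Longrightarrow> (q, k) \<in> A1 \<Longrightarrow> p = q"
    using step_nest1[OF 1] by auto
  have r: "\<And>p k. (p, k) \<in> A2 \<Longrightarrow> Suc j \<le> k" "\<And>p q k. (p, k) \<in> A2 \<Longrightarrow> (q, k) \<in> A2 \<Longrightarrow> p = q"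
    using Cons.IH[OF 2] by auto
  have "p = q" if "(p, k) \<in> A" "(q, k) \<in> A" for p q k
    using that s r unfolding A by (metis Un_iff not_less_eq_eq order_refl)
  moreover have "j \<le> k" if "(p, k) \<in> A" for p k
    using that s(1) r(1) unfolding A by (metis Suc_leD Un_iff order_refl)
  ultimately show ?case by blast
qed simp

lemma functional_nesting_2nw: "is_2nw N \<Longrightarrow> functional_nesting N"
  unfolding is_2nw_def gen_by_def functional_nesting_def
  by (cases N) (auto dest: run_ops_nest1_unique)

lemma run_ops_append:
  "run_ops j st xs = Some (st1, A, B) \<Longrightarrow> run_ops (j + length xs) st1 ys = Some (st2, C, D) \<Longrightarrow>
    run_ops j st (xs @ ys) = Some (st2, A \<union> C, B \<union> D)"
proof (induction xs arbitrary: j st A B)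
  case (Cons op xs)
  then show ?case
    by (fastforce split: option.splits prod.splits)
qed simp

definition base_stack :: "nat \<Rightarrow> nat tstack" where
  "base_stack m = [(None, map (\<lambda>p. (0, 0, p)) [0..<m])]"

lemma run_ops_pushes:
  "run_ops 0 init_stack (replicate m (Push1 0)) = Some (base_stack m, {}, {})"
proof (induction m)
  case (Suc m)
  have "run_ops 0 init_stack (replicate m (Push1 0) @ [Push1 0]) = Some (base_stack (Suc m), {}, {})"
    using run_ops_append[OF Suc, of "[Push1 0]"] by (simp add: base_stack_def)
  then show ?case by (simp add: replicate_append_same)
qed (simp add: init_stack_def base_stack_def)

text \<open>Letters leave the stack in reverse order, whence the offset \<open>m - Suc p\<close>.
  \<open>Push2\<close> copies the tags along with the letters, so pops from a copy refer to the
  original pushes at the positions below \<open>m\<close>.\<close>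

lemma run_ops_pops:
  "run_ops j [b, (q, map (\<lambda>p. (0, 0, p)) [0..<m])] (replicate m Pop1) =
     Some ([b, (q, [])], {(p, j + (m - Suc p)) | p. p < m}, {})"
proof (induction m arbitrary: j)
  case (Suc m)
  have "{(m, j)} \<union> {(p, Suc j + (m - Suc p)) | p. p < m} = {(p, j + (Suc m - Suc p)) | p. p < Suc m}"
    by (auto simp: less_Suc_eq)
  then show ?case using Suc[of "Suc j"] by simp
qed simp

definition row_ops :: "nat \<Rightarrow> nat stackop list" where
  "row_ops m = Push2 # replicate m Pop1 @ [Pop2]"

lemma run_ops_row:
  "run_ops j (base_stack m) (row_ops m) =
     Some (base_stack m, {(p, j + (m - p)) | p. p < m}, {(j, j + Suc m)})"
proof -
  have eq: "{(p, Suc j + (m - Suc p)) | p. p < m} = {(p, j + (m - p)) | p. p < m}"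
    by (auto simp: Suc_diff_Suc)
  have "run_ops (Suc j) [hd (base_stack m), (Some j, map (\<lambda>p. (0, 0, p)) [0..<m])] (replicate m Pop1 @ [Pop2])
      = Some ([hd (base_stack m)], {(p, j + (m - p)) | p. p < m}, {(j, j + Suc m)})"
    using run_ops_append[OF run_ops_pops[of "Suc j" "hd (base_stack m)" "Some j" m], of "[Pop2]"]
    unfolding eq by simp
  then show ?thesis by (simp add: row_ops_def base_stack_def)
qed

lemma run_ops_rows:
  "\<exists>B. run_ops j (base_stack m) (concat (replicate n (row_ops m))) =
     Some (base_stack m, {(p, j + i * (m + 2) + (m - p)) | i p. i < n \<and> p < m}, B)"
proof (induction n arbitrary: j)
  case (Suc n)
  have len: "length (row_ops m) = m + 2" by (simp add: row_ops_def)
  obtain B where B: "run_ops (j + length (row_ops m)) (base_stack m) (concat (replicate n (row_ops m))) =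
     Some (base_stack m, {(p, j + (m + 2) + i * (m + 2) + (m - p)) | i p. i < n \<and> p < m}, B)"
    using Suc[of "j + (m + 2)"] unfolding len by blast
  have "{(p, j + (m - p)) | p. p < m} \<union> {(p, j + (m + 2) + i * (m + 2) + (m - p)) | i p. i < n \<and> p < m}
      = {(p, j + i * (m + 2) + (m - p)) | i p. i < Suc n \<and> p < m}" (is "?A \<union> ?B = ?C")
  proof
    show "?A \<union> ?B \<subseteq> ?C"
    proof
      fix z assume "z \<in> ?A \<union> ?B"
      then consider (first) p where "z = (p, j + (m - p))" "p < m"
        | (later) i p where "z = (p, j + (m + 2) + i * (m + 2) + (m - p))" "i < n" "p < m"
        by blast
      then show "z \<in> ?C"
      proof cases
        case first
        then have "z = (p, j + 0 * (m + 2) + (m - p))" "0 < Suc n" by simp_all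
        with first show ?thesis by blast
      next
        case later
        then have "z = (p, j + Suc i * (m + 2) + (m - p))" "Suc i < Suc n" by simp_all
        with later show ?thesis by blast
      qed
    qed
    show "?C \<subseteq> ?A \<union> ?B"
    proof
      fix z assume "z \<in> ?C"
      then obtain i p where z: "z = (p, j + i * (m + 2) + (m - p))" "i < Suc n" "p < m" by blast
      show "z \<in> ?A \<union> ?B"
      proof (cases i)
        case 0
        with z show ?thesis by simp
      next
        case (Suc i')
        then have "z = (p, j + (m + 2) + i' * (m + 2) + (m - p))" "i' < n" using z by simp_all
        with z(3) show ?thesis by blast
      qed
    qed
  qed
  then show ?case using run_ops_append[OF run_ops_row B] by simp
qed simp

section \<open>An automaton for all grids\<close>

definition cell_letter :: "nat \<Rightarrow> store \<Rightarrow> nat \<Rightarrow> nat" where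
  "cell_letter R \<sigma> p = 6 + set_encode {x. x < R \<and> p < \<sigma> x}"

definition row_run :: "nat \<Rightarrow> nat \<Rightarrow> nat \<times> store \<Rightarrow> (nat \<times> nat \<times> nat stackop \<times> nat) list" where
  "row_run R m = (\<lambda>(a, \<sigma>). (0, a, Push2, 1) #
     map (\<lambda>p. (1, cell_letter R \<sigma> p, Pop1, 1)) (rev [0..<m]) @ [(1, 5, Pop2, 0)])"

definition grid_run :: "nat \<Rightarrow> nat \<Rightarrow> (nat \<times> store) list \<Rightarrow> (nat \<times> nat \<times> nat stackop \<times> nat) list" where
  "grid_run R m rs = replicate m (0, 5, Push1 0, 0) @ concat (map (row_run R m) rs)"

text \<open>The state is the height of the stack minus 1, which bounds the height by 2. The
  automaton neither aligns rows nor checks marks; that is left to the sentence, and only the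
  alphabet depends on \<open>R\<close>.\<close>

definition grid_cpds :: "nat \<Rightarrow> cpds" where
  "grid_cpds R = ((0, 5, Push1 0, 0) # map (\<lambda>a. (0, a, Push2, 1)) [0..<5] @
     map (\<lambda>a. (1, 6 + a, Pop1, 1)) [0..<2 ^ R] @ [(1, 5, Pop2, 0)], 0, [0])"

lemma cpds_nocollapse_grid_cpds: "cpds_nocollapse (grid_cpds R)"
  by (auto simp: cpds_nocollapse_def grid_cpds_def tr_op_def)

lemma cpds_height_bounded_grid_cpds: "cpds_height_bounded 2 (grid_cpds R)"
proof -
  have bound: "length st' \<le> 2"
    if "chain q ts" "set ts \<subseteq> set (fst (grid_cpds R))" "length st = Suc q" "q \<le> 1"
      "run_ops j st (map tr_op ts) = Some (st', A, B)" for q ts st j st' A B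
    using that
  proof (induction ts arbitrary: q st j A B)
    case (Cons t ts)
    obtain p a op p' where t: "t = (p, a, op, p')" by (cases t)
    then have "tr_op t = op" by (simp add: tr_op_def)
    from Cons.prems(1) have p: "p = q" "chain p' ts" by (simp_all add: t)
    from Cons.prems(5) obtain st1 A1 B1 A2 B2 where 1: "step j op st = Some (st1, A1, B1)"
      and 2: "run_ops (Suc j) st1 (map tr_op ts) = Some (st', A2, B2)"
      using \<open>tr_op t = op\<close> by (auto split: option.splits prod.splits)
    have "t \<in> set (fst (grid_cpds R))" using Cons.prems(2) by simp
    then have "length st1 = Suc p' \<and> p' \<le> 1"
      using 1 p Cons.prems(3) by (auto simp: grid_cpds_def t split: if_splits)
    then show ?case using Cons.IH[OF p(2) _ _ _ 2] Cons.prems(2) by simp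
  qed simp
  show ?thesis
    unfolding cpds_height_bounded_def
  proof (intro allI impI)
    fix ts st R1 R2
    assume "is_run (grid_cpds R) ts"
      and run: "run_ops 0 init_stack (map tr_op ts) = Some (st, R1, R2)"
    then have "chain 0 ts" "set ts \<subseteq> set (fst (grid_cpds R))"
      unfolding is_run_def by (simp_all add: grid_cpds_def)
    from bound[OF this _ _ run] show "length st \<le> 2" by (simp add: init_stack_def)
  qed
qed

lemma chain_append: "chain q xs \<Longrightarrow> (xs \<noteq> [] \<Longrightarrow> tr_target (last xs) = r) \<Longrightarrow> (xs = [] \<Longrightarrow> q = r) \<Longrightarrow>
    chain r ys \<Longrightarrow> chain q (xs @ ys)"
  by (induction q xs rule: chain.induct) (auto simp: tr_target_def split: if_splits)

lemma set_encode_below: "A \<subseteq> {..<n} \<Longrightarrow> set_encode A < 2 ^ n"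
proof -
  assume "A \<subseteq> {..<n}"
  then have "set_encode A \<le> (\<Sum>i\<in>{..<n}. 2 ^ i)"
    unfolding set_encode_def by (intro sum_mono2) auto
  also have "\<dots> = 2 ^ n - (1::nat)"
    by (induction n) auto
  also have "\<dots> < 2 ^ n" by simp
  finally show ?thesis .
qed

lemma chain_row_run: "chain 0 (row_run R m r)"
proof -
  have 1: "chain 1 (map (\<lambda>p. (1, f p, Pop1, 1)) ps @ [(1, 5, Pop2, 0)])" for f :: "nat \<Rightarrow> nat" and ps
    by (induction ps) auto
  show ?thesis by (cases r) (simp add: row_run_def 1[simplified])
qed

lemma chain_concat_row_run: "chain 0 (concat (map (row_run R m) rs))"
proof (induction rs)
  case (Cons r rs)
  have "row_run R m r \<noteq> []" "tr_target (last (row_run R m r)) = 0"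
    by (cases r; simp add: row_run_def tr_target_def)+
  then show ?case
    using chain_append[OF chain_row_run[of R m r] _ _ Cons] by simp
qed simp

lemma chain_grid_run: "chain 0 (grid_run R m rs)"
proof -
  have "chain 0 (replicate m (0, 5, Push1 0, 0))" by (induction m) auto
  then show ?thesis
    unfolding grid_run_def by (rule chain_append) (auto simp: tr_target_def chain_concat_row_run)
qed

lemma set_grid_run:
  assumes "\<forall>r\<in>set rs. fst r < 5"
  shows "set (grid_run R m rs) \<subseteq> set (fst (grid_cpds R))"
proof -
  have "set (row_run R m r) \<subseteq> set (fst (grid_cpds R))" if "r \<in> set rs" for r
  proof -
    obtain a \<sigma> where r: "r = (a, \<sigma>)" by (cases r)
    have "set_encode {x. x < R \<and> p < \<sigma> x} < 2 ^ R" for p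
      by (intro set_encode_below) auto
    moreover have "a < 5" using assms that r by auto
    ultimately show ?thesis by (auto simp: row_run_def grid_cpds_def cell_letter_def r)
  qed
  moreover have "(0, 5, Push1 0, 0) \<in> set (fst (grid_cpds R))" by (simp add: grid_cpds_def)
  ultimately show ?thesis by (auto simp: grid_run_def)
qed

lemma ops_grid_run:
  "map tr_op (grid_run R m rs) = replicate m (Push1 0) @ concat (replicate (length rs) (row_ops m))"
proof -
  have "map tr_op (row_run R m r) = row_ops m" for r
    by (cases r) (simp add: row_run_def row_ops_def tr_op_def comp_def map_replicate_const)
  then have "map tr_op (concat (map (row_run R m) rs)) = concat (replicate (length rs) (row_ops m))"
    by (induction rs) auto
  then show ?thesis by (simp add: grid_run_def tr_op_def map_replicate_const)
qed

definition row_word :: "nat \<Rightarrow> nat \<Rightarrow> nat \<times> store \<Rightarrow> nat list" where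
  "row_word R m = (\<lambda>(a, \<sigma>). a # map (cell_letter R \<sigma>) (rev [0..<m]) @ [5])"

definition grid_nw :: "nat \<Rightarrow> nat \<Rightarrow> (nat \<times> store) list \<Rightarrow> rel \<Rightarrow> nw" where
  "grid_nw R m rs B = (replicate m 5 @ concat (map (row_word R m) rs),
     {(p, m + i * (m + 2) + (m - p)) | i p. i < length rs \<and> p < m}, B)"

lemma grid_nw_in_lang:
  assumes "\<forall>r\<in>set rs. fst r < 5" "rs \<noteq> []"
  shows "\<exists>B. grid_nw R m rs B \<in> lang (grid_cpds R)"
proof -
  let ?ts = "grid_run R m rs"
  obtain B where "run_ops m (base_stack m) (concat (replicate (length rs) (row_ops m))) =
     Some (base_stack m, {(p, m + i * (m + 2) + (m - p)) | i p. i < length rs \<and> p < m}, B)"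
    using run_ops_rows by blast
  then have run: "run_ops 0 init_stack (map tr_op ?ts) =
     Some (base_stack m, {(p, m + i * (m + 2) + (m - p)) | i p. i < length rs \<and> p < m}, B)"
    unfolding ops_grid_run using run_ops_append[OF run_ops_pushes] by simp
  have "map tr_letter (row_run R m r) = row_word R m r" for r
    by (cases r) (simp add: row_run_def row_word_def tr_letter_def comp_def)
  then have word: "map tr_letter ?ts = replicate m 5 @ concat (map (row_word R m) rs)"
    by (simp add: grid_run_def tr_letter_def map_concat comp_def)
  obtain rs' r where rs: "rs = rs' @ [r]" using assms(2) by (metis append_butlast_last_id)
  have "?ts \<noteq> []" "tr_target (last ?ts) = 0"
    by (auto simp: rs grid_run_def row_run_def tr_target_def split: prod.splits)
  moreover have "is_run (grid_cpds R) ?ts"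
    using set_grid_run[OF assms(1)] chain_grid_run run by (simp add: is_run_def) (simp add: grid_cpds_def)
  ultimately have "grid_nw R m rs B \<in> lang (grid_cpds R)"
    unfolding lang_def grid_nw_def using run word by (force simp: grid_cpds_def)
  then show ?thesis by blast
qed

text \<open>The height must be bounded on every prefix. A prefix of a run is a run, though perhaps
  not an accepting one, and \<open>cpds_height_bounded\<close> speaks of all runs.\<close>

lemma lang_bounded:
  assumes "N \<in> lang H" "cpds_nocollapse H" "cpds_height_bounded k H"
  shows "is_2nw_nocollapse_bounded k N"
proof -
  from assms(1) obtain ts st R1 R2 where N: "N = (map tr_letter ts, R1, R2)" "ts \<noteq> []" "is_run H ts"
    and run: "run_ops 0 init_stack (map tr_op ts) = Some (st, R1, R2)"
    unfolding lang_def by blast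
  have "Collapse \<notin> set (map tr_op ts)"
    using assms(2) N(3) by (fastforce simp: cpds_nocollapse_def is_run_def)
  moreover have "height_bounded_ops k (map tr_op ts)"
    unfolding height_bounded_ops_def
  proof (intro allI impI)
    fix n st R1 R2
    assume "run_ops 0 init_stack (take n (map tr_op ts)) = Some (st, R1, R2)"
    then have r: "run_ops 0 init_stack (map tr_op (take n ts)) = Some (st, R1, R2)"
      by (simp add: take_map)
    have "chain q (take n xs)" if "chain q xs" for q xs
      using that by (induction q xs arbitrary: n rule: chain.induct) (auto simp: take_Cons split: nat.splits)
    then have "is_run H (take n ts)"
      using N(3) r set_take_subset[of n ts] by (auto simp: is_run_def)
    then show "length st \<le> k" using assms(3) r unfolding cpds_height_bounded_def by blast
  qed
  ultimately show ?thesis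
    unfolding is_2nw_nocollapse_bounded_def gen_by_def N(1) using N(2) run
    by (intro exI[of _ "map tr_op ts"]) auto
qed

lemma is_2nw_if_bounded: "is_2nw_nocollapse_bounded k N \<Longrightarrow> is_2nw N"
  unfolding is_2nw_nocollapse_bounded_def is_2nw_def by blast

section \<open>Coordinates in a grid\<close>

lemma nth_concat_uniform:
  "\<forall>xs\<in>set xss. length xs = n \<Longrightarrow> i < length xss \<Longrightarrow> k < n \<Longrightarrow> concat xss ! (i * n + k) = xss ! i ! k"
proof (induction xss arbitrary: i)
  case (Cons xs xss)
  then show ?case by (cases i) (auto simp: nth_append add.assoc)
qed simp

locale grid =
  fixes R m :: nat and rs :: "(nat \<times> store) list" and B :: rel
  assumes letter_less: "r \<in> set rs \<Longrightarrow> fst r < 5"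
    and fits: "r \<in> set rs \<Longrightarrow> x < R \<Longrightarrow> snd r x \<le> m"
begin

abbreviation N :: nw where "N \<equiv> grid_nw R m rs B"

text \<open>The \<open>m\<close> pushes come first, and a row takes \<open>m + 2\<close> positions:
  \<open>Push2\<close>, the \<open>m\<close> pops and \<open>Pop2\<close>.\<close>

definition pos :: "nat \<Rightarrow> nat" where
  "pos i = m + i * (m + 2)"

lemma length_word: "length (fst N) = pos (length rs)"
proof -
  have "length (concat (map (row_word R m) rs)) = length rs * (m + 2)"
    by (induction rs) (auto simp: row_word_def split: prod.splits)
  then show ?thesis by (simp add: grid_nw_def pos_def)
qed

lemma pos_Suc: "pos (Suc i) = pos i + (m + 2)"
  by (simp add: pos_def)

lemma pos_mono: "i \<le> j \<Longrightarrow> pos i \<le> pos j"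
  using mult_le_mono1[of i j "m + 2"] by (simp only: pos_def add_le_cancel_left)

lemma pos_cases:
  assumes "j < length (fst N)"
  obtains "j < m" | i k where "i < length rs" "k < m + 2" "j = pos i + k"
proof (cases "j < m")
  case False
  define i k where "i = (j - m) div (m + 2)" and "k = (j - m) mod (m + 2)"
  have j: "j = pos i + k" using False unfolding i_def k_def pos_def
    by (metis add.assoc div_mult_mod_eq le_add_diff_inverse not_less)
  have "k < m + 2" unfolding k_def by simp
  moreover have "i < length rs"
    using assms j length_word pos_mono[of "length rs" i] by linarith
  ultimately show ?thesis using that(2) j by blast
qed (use that in blast)

lemma pos_unique:
  assumes "pos i + k = pos i' + k'" "k < m + 2" "k' < m + 2"
  shows "i = i' \<and> k = k'"
proof -
  have "i * (m + 2) + k = i' * (m + 2) + k'" using assms(1) by (simp add: pos_def)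
  then have "(i * (m + 2) + k) div (m + 2) = (i' * (m + 2) + k') div (m + 2)"
    "(i * (m + 2) + k) mod (m + 2) = (i' * (m + 2) + k') mod (m + 2)" by (simp_all only:)
  then show ?thesis using assms(2,3) by (simp only: div_mult_self3 mod_mult_self3 div_less mod_less) auto
qed

lemma pos_add_less: "i < length rs \<Longrightarrow> k < m + 2 \<Longrightarrow> pos i + k < length (fst N)"
  using pos_mono[of "Suc i" "length rs"] unfolding length_word pos_Suc by linarith

lemma word_nth:
  assumes "i < length rs" "k < m + 2"
  shows "fst N ! (pos i + k) = row_word R m (rs ! i) ! k"
proof -
  have "fst N ! (pos i + k) = concat (map (row_word R m) rs) ! (i * (m + 2) + k)"
    by (simp add: grid_nw_def pos_def nth_append add.assoc)
  also have "\<dots> = row_word R m (rs ! i) ! k"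
    using assms by (subst nth_concat_uniform) (auto simp: row_word_def)
  finally show ?thesis .
qed

lemma word_pos: "i < length rs \<Longrightarrow> fst N ! pos i = fst (rs ! i)"
  using word_nth[of i 0] by (simp add: row_word_def split: prod.splits)

lemma word_cell:
  assumes "i < length rs" "p < m"
  shows "fst N ! (pos i + (m - p)) = cell_letter R (snd (rs ! i)) p"
proof -
  have "m - p = Suc (m - Suc p)" using assms(2) by simp
  then show ?thesis
    using word_nth[OF assms(1), of "m - p"] assms(2)
    by (auto simp: row_word_def nth_append rev_nth split: prod.splits)
qed

lemma word_high:
  assumes "j < length (fst N)" "\<And>i. i < length rs \<Longrightarrow> j \<noteq> pos i"
  shows "fst N ! j \<ge> 5"
  using assms(1)
proof (cases rule: pos_cases)
  case 1
  then show ?thesis by (simp add: grid_nw_def nth_append)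
next
  case (2 i k)
  have "k \<noteq> 0" using assms(2)[OF 2(1)] 2(3) by auto
  then obtain l where "k = Suc l" by (cases k) auto
  then show ?thesis
    using word_nth[OF 2(1,2)] 2
    by (auto simp: row_word_def cell_letter_def nth_append split: prod.splits)
qed

lemma opens_iff: "opens N j \<longleftrightarrow> (\<exists>i<length rs. j = pos i)"
proof
  assume "opens N j"
  then show "\<exists>i<length rs. j = pos i" using word_high[of j] by (force simp: opens_def)
next
  assume "\<exists>i<length rs. j = pos i"
  then show "opens N j"
    using word_pos letter_less[OF nth_mem] pos_add_less[of _ 0] by (auto simp: opens_def)
qed

lemma between_rows:
  assumes "pos i < j" "j < pos (Suc i)"
  shows "\<not> opens N j"
proof
  assume "opens N j"
  then obtain i' where "j = pos i'" using opens_iff by blast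
  then show False using assms pos_mono[of i' i] pos_mono[of "Suc i" i'] by linarith
qed

lemma in_row_iff:
  assumes "i < length rs"
  shows "in_row N (pos i) j \<longleftrightarrow> (\<exists>k<m + 2. j = pos i + k)"
proof
  assume j: "in_row N (pos i) j"
  have "j < pos (Suc i)"
  proof (rule ccontr)
    assume "\<not> j < pos (Suc i)"
    moreover from this have "Suc i < length rs"
      using j length_word pos_mono[of "length rs" "Suc i"] unfolding in_row_def by linarith
    moreover from this have "opens N (pos (Suc i))" using opens_iff by blast
    moreover have "pos i < pos (Suc i)" by (simp add: pos_Suc)
    ultimately show False
      using j unfolding in_row_def by (meson not_less)
  qed
  then show "\<exists>k<m + 2. j = pos i + k"
    using j unfolding in_row_def pos_Suc by (intro exI[of _ "j - pos i"]) auto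
next
  assume "\<exists>k<m + 2. j = pos i + k"
  then obtain k where "k < m + 2" "j = pos i + k" by blast
  then show "in_row N (pos i) j"
    using pos_add_less[OF assms] between_rows[of i] unfolding in_row_def pos_Suc by auto
qed

text \<open>Coordinates are unique, so a nesting pair that ends in row \<open>i\<close> was created
  by row \<open>i\<close>. The push then fixes the cell, which gives
  \<open>column_unique\<close>.\<close>

lemma nest_in_row:
  assumes "i < length rs" "in_row N (pos i) j" "(p, j) \<in> fst (snd N)"
  shows "p < m" "j = pos i + (m - p)"
proof -
  from assms(3) obtain i' where i': "p < m" "j = pos i' + (m - p)"
    by (auto simp: grid_nw_def pos_def)
  moreover obtain k where "k < m + 2" "j = pos i + k" using assms in_row_iff by blast
  ultimately have "i' = i" using pos_unique[of i' "m - p" i k] by auto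
  then show "p < m" "j = pos i + (m - p)" using i' by auto
qed

lemma regset_grid:
  assumes "i < length rs" "x < R"
  shows "regset R N (pos i) x = {..<snd (rs ! i) x}"
proof -
  have mark: "mark R N x (pos i + (m - p)) \<longleftrightarrow> p < snd (rs ! i) x" if "p < m" for p
  proof -
    have "set_encode {x. x < R \<and> p < snd (rs ! i) x} < 2 ^ R"
      by (intro set_encode_below) auto
    moreover have "set_decode (set_encode {x. x < R \<and> p < snd (rs ! i) x}) = {x. x < R \<and> p < snd (rs ! i) x}"
      by (intro set_encode_inverse) auto
    ultimately show ?thesis
      using word_cell[OF assms(1) that] pos_add_less[OF assms(1), of "m - p"] assms(2)
      by (auto simp: mark_def cell_letter_def)
  qed
  have "p \<in> regset R N (pos i) x \<longleftrightarrow> p < m \<and> p < snd (rs ! i) x" for p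
  proof
    assume "p \<in> regset R N (pos i) x"
    then obtain j where j: "in_row N (pos i) j" "mark R N x j" "(p, j) \<in> fst (snd N)"
      by (auto simp: regset_def)
    show "p < m \<and> p < snd (rs ! i) x"
      using nest_in_row[OF assms(1) j(1,3)] j(2) mark[of p] by simp
  next
    assume p: "p < m \<and> p < snd (rs ! i) x"
    moreover have "in_row N (pos i) (pos i + (m - p))"
      using in_row_iff[OF assms(1)] by auto
    moreover have "(p, pos i + (m - p)) \<in> fst (snd N)"
      using assms(1) p by (auto simp: grid_nw_def pos_def)
    ultimately show "p \<in> regset R N (pos i) x" using mark unfolding regset_def by blast
  qed
  moreover have "snd (rs ! i) x \<le> m" using fits assms by simp
  ultimately show ?thesis by (auto intro: less_le_trans)
qed

lemma rows_grid:
  assumes "functional_nesting N"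
  shows "rows N R pos (map snd rs)"
proof -
  interpret functional_nesting N R by (rule assms)
  show ?thesis
  proof
    show "opens N (pos i)" if "i < length (map snd rs)" for i
      using that opens_iff by auto
    show "next_row N (pos i) (pos (Suc i))" if "Suc i < length (map snd rs)" for i
      using that opens_iff between_rows unfolding next_row_def by (auto simp: pos_Suc)
    show "regset R N (pos i) x = {..<(map snd rs ! i) x}" if "i < length (map snd rs)" "x < R" for i x
      using regset_grid that by simp
    show "j = k" if "i < length (map snd rs)" "in_row N (pos i) j" "in_row N (pos i) k"
      "(q, j) \<in> fst (snd N)" "(q, k) \<in> fst (snd N)" for i j k q
      using nest_in_row(2)[of i j q] nest_in_row(2)[of i k q] that by simp
  qed
qed

end

section \<open>From computations to words, and the simulation\<close>

lemma input_sentence_grid: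
  assumes run: "(\<sigma>, \<tau>) \<in> psem p" and \<sigma>: "\<sigma> = (\<lambda>_. 0)(0 := x, 1 := y)"
    and R: "2 \<le> R" "regs p \<le> R"
  shows "\<exists>N\<in>lang (grid_cpds R). models N (input_sentence (run_formula R p) x y)"
proof -
  obtain T where T: "\<And>pre post. (length pre, length pre + length T) \<in> along (pre @ (\<sigma> # T) @ post) p"
    using psem_along[OF run] by blast
  define n where "n = 2 + x + y"
  \<comment> \<open>A row announces the assignment that leads to the following row. So the rows 0
    and 1 may have the zero store, each counting row holds the count before its own increment, and
    row \<open>n\<close> starts the run of \<open>p\<close>.\<close>
  define store_at where "store_at i = (if i < 2 then (\<lambda>_. 0) else if i < 2 + x then (\<lambda>_. 0)(0 := i - 2)
    else if i < n then (\<lambda>_. 0)(0 := x, 1 := i - (2 + x)) else (\<sigma> # T) ! (i - n))" for i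
  define letter_at :: "nat \<Rightarrow> nat" where "letter_at i = (if i = 0 then 1 else if i = 1 then 2
    else if i < 2 + x then 3 else if i < n then 4 else 0)" for i
  define rs where "rs = map (\<lambda>i. (letter_at i, store_at i)) [0..<n + Suc (length T)]"
  have rs_nth: "rs ! i = (letter_at i, store_at i)" if "i < n + Suc (length T)" for i
    using that by (simp add: rs_def del: upt_Suc)
  have len: "length rs = n + Suc (length T)" by (simp add: rs_def)
  \<comment> \<open>As many columns as the largest value of a register below \<open>R\<close> in any
    row; the automaton does not limit their number.\<close>
  define m where "m = Max (insert 0 ((\<lambda>(r, x). snd r x) ` (set rs \<times> {..<R})))"
  have small: "\<forall>r\<in>set rs. fst r < 5"
    by (auto simp: rs_def letter_at_def)
  moreover have "rs \<noteq> []" using len by auto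
  ultimately obtain B where B: "grid_nw R m rs B \<in> lang (grid_cpds R)"
    using grid_nw_in_lang by blast
  interpret grid R m rs B
  proof
    show "fst r < 5" if "r \<in> set rs" for r using small that by blast
    show "snd r x \<le> m" if "r \<in> set rs" "x < R" for r x
      unfolding m_def using that by (intro Max_ge) (force simp del: set_map)+
  qed
  have "functional_nesting N"
    using B lang_bounded cpds_nocollapse_grid_cpds cpds_height_bounded_grid_cpds
      is_2nw_if_bounded functional_nesting_2nw by blast
  then interpret rows N R pos "map snd rs" by (rule rows_grid)
  \<comment> \<open>The bound includes \<open>k = x\<close>: that row belongs to the next branch of
    \<open>store_at\<close>, or to the run itself if \<open>y = 0\<close>, and has the expected
    store there too.\<close>
  have store1: "store_at (2 + k) = (\<lambda>_. 0)(0 := k)" if "k \<le> x" for k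
    using that \<sigma> by (cases "k < x"; cases "y = 0") (auto simp: store_at_def n_def fun_eq_iff)
  have store2: "store_at (2 + x + k) = (\<lambda>_. 0)(0 := x, 1 := k)" if "k \<le> y" for k
    using that \<sigma> by (cases "k < y") (auto simp: store_at_def n_def)
  have index: "letter_at i = 1 \<Longrightarrow> i = 0" "letter_at i = 2 \<Longrightarrow> i = 1"
    "letter_at i = 3 \<Longrightarrow> \<exists>k<x. i = 2 + k" "letter_at i = 4 \<Longrightarrow> \<exists>k<y. i = 2 + x + k" for i
    unfolding letter_at_def n_def
       apply (simp_all split: if_splits)
     apply presburger+
    done
  have announced_step: "Suc i < length rs \<and> store_at (Suc i) = (store_at i)(r := eval_expr e (store_at i))"
    if a: "(a, r, e) \<in> set announcements" "letter_at i = a" for a r e i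
  proof -
    from a(1) consider "a = 1" "r = 0" "e = Zero" | "a = 2" "r = 1" "e = Zero"
      | "a = 3" "r = 0" "e = Succ 0" | "a = 4" "r = 1" "e = Succ 1"
      by (auto simp: announcements_def)
    then show ?thesis
    proof cases
      case 1
      then have "i = 0" using a(2) index(1) by simp
      then show ?thesis unfolding 1 by (auto simp: len n_def store_at_def)
    next
      case 2
      then have "i = 1" using a(2) index(2) by simp
      moreover have "store_at (Suc 1) = (\<lambda>_. 0)" using store1[of 0] by (simp add: fun_eq_iff numeral_2_eq_2)
      moreover have "store_at 1 = (\<lambda>_. 0)" by (simp add: store_at_def)
      ultimately show ?thesis unfolding 2 by (simp add: len n_def fun_eq_iff)
    next
      case 3
      then obtain k where k: "k < x" "i = 2 + k" using a(2) index(3) by blast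
      then show ?thesis
        unfolding 3 using store1[of k] store1[of "Suc k"] by (simp add: len n_def)
    next
      case 4
      then obtain k where k: "k < y" "i = 2 + x + k" using a(2) index(4) by blast
      then show ?thesis
        unfolding 4 using store2[of k] store2[of "Suc k"] by (simp add: len n_def)
    qed
  qed
  have "models N (input_sentence (run_formula R p) x y)"
  proof (rule input_sentence_complete)
    show "2 + x + y < length (map snd rs)" using len n_def by simp
    show "fst N ! pos 0 = 1" "fst N ! pos 1 = 2"
      using word_pos[of 0] word_pos[of 1] rs_nth[of 0] rs_nth[of 1] len
      by (auto simp: letter_at_def n_def)
    show "fst N ! pos (2 + k) = 3" if "k < x" for k
      using word_pos[of "2 + k"] rs_nth[of "2 + k"] len that by (auto simp: letter_at_def n_def)
    show "fst N ! pos (2 + x + k) = 4" if "k < y" for k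
      using word_pos[of "2 + x + k"] rs_nth[of "2 + x + k"] len that by (auto simp: letter_at_def n_def)
    show "sem_n N (assigns R r e) q"
      if a: "(a, r, e) \<in> set announcements" "q < length (fst N)" "fst N ! q = a" for a r e q
    proof -
      have "a < 5" using a(1) by (auto simp: announcements_def)
      then obtain i where i: "i < length rs" "q = pos i"
        using word_high[OF a(2)] a(3) by force
      then have "letter_at i = a" using a(3) word_pos rs_nth len by auto
      from announced_step[OF a(1) this]
      have "sem_n N (assigns R r e) (pos i)"
        using a(1) R(1) rs_nth len by (intro assigns_complete) (auto simp: announcements_def)
      with i show ?thesis by simp
    qed
    have "map snd rs = map store_at [0..<n] @ (\<sigma> # T) @ []"
      by (rule nth_equalityI)
         (auto simp: len rs_nth nth_append store_at_def n_def simp del: upt_Suc)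
    then show "(2 + x + y, n + length T) \<in> along (map snd rs) p"
      using T[of "map store_at [0..<n]" "[]"] by (simp add: n_def)
    show "regs p \<le> R" by (rule R(2))
  qed
  with B show ?thesis by blast
qed

text \<open>The two directions are uneven: soundness holds for all nested words, completeness finds
  a word of one grid automaton. So the same formula serves satisfiability, bounded or not, and model
  checking.\<close>

lemma recf_simulation:
  "\<exists>R \<phi>. (\<forall>x y N. is_2nw N \<longrightarrow> models N (input_sentence \<phi> x y) \<longrightarrow> (\<exists>v. reval g [x, y] v)) \<and>
     (\<forall>x y v. reval g [x, y] v \<longrightarrow> (\<exists>N\<in>lang (grid_cpds R). models N (input_sentence \<phi> x y)))"
proof -
  define p where "p = compile g [0, 1] 2 3"
  \<comment> \<open>At least 2, because the announcements use the registers 0 and 1 whether or not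
    \<open>p\<close> mentions them.\<close>
  define R where "R = max 2 (regs p)"
  have p: "computes p 3 2 (\<lambda>s. reval g (map s [0, 1]))"
    unfolding p_def by (rule computes_compile) auto
  show ?thesis
  proof (rule exI[of _ R], rule exI[of _ "run_formula R p"], intro conjI allI impI)
    fix x y N assume N: "is_2nw N" "models N (input_sentence (run_formula R p) x y)"
    interpret functional_nesting N R by (rule functional_nesting_2nw[OF N(1)])
    obtain \<sigma> \<tau> where "(\<sigma>, \<tau>) \<in> psem p" "\<sigma> 0 = x" "\<sigma> 1 = y"
      using input_sentence_sound[OF N(2)] by blast
    then show "\<exists>v. reval g [x, y] v" using computesD(1)[OF p] by fastforce
  next
    fix x y v assume "reval g [x, y] v"
    then have "reval g (map ((\<lambda>_. 0)(0 := x, 1 := y)) [0, 1 :: nat]) v" by simp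
    then obtain \<tau> where "((\<lambda>_. 0)(0 := x, 1 := y), \<tau>) \<in> psem p"
      using p unfolding computes_def by blast
    then show "\<exists>N\<in>lang (grid_cpds R). models N (input_sentence (run_formula R p) x y)"
      by (rule input_sentence_grid) (auto simp: R_def)
  qed
qed

section \<open>Codes of the instances and undecidability\<close>

definition rf_sentence :: recf where
  "rf_sentence = Cn rf_pair [rf_const 0,
     Cn (rf_diam_pow (announced 1)) [rf_const 1, Cn (rf_diam_pow (announced 2)) [rf_const 1,
       Cn (rf_diam_pow (announced 3)) [Pj 0, Cn (rf_diam_pow (announced 4)) [Pj 1, Pj 0]]]]]"

text \<open>\<open>Pj 0\<close> occurs twice in \<open>rf_sentence\<close>, as a number of rows and
  as the code to be wrapped: the formula receives its own code as input.\<close>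

lemma reval_rf_sentence:
  "reval rf_sentence [enc_n \<phi>, y] (enc_sent (input_sentence \<phi> (enc_n \<phi>) y))"
proof -
  have "input_sentence \<phi> (enc_n \<phi>) y = E ((Diam (announced 1) ^^ 1) ((Diam (announced 2) ^^ 1)
        ((Diam (announced 3) ^^ enc_n \<phi>) ((Diam (announced 4) ^^ y) \<phi>))))"
    by (simp add: input_sentence_def)
  then show ?thesis
    unfolding rf_sentence_def
    by (simp only: enc_sent.simps)
       (intro reval_pair_of reval_rf_const reval_Cn2[OF _ _ reval_rf_diam_pow] reval_Pj0 reval_Pj1)
qed

definition rf_mc :: recf where
  "rf_mc = Cn rf_pair [Cn rf_pair [rf_const 2, rf_sentence], Pj 1]"

text \<open>The second input is at once the number \<open>y\<close> of rows and the code of the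
  automaton in the instance; the tag 2 is that of \<open>SNeg\<close>.\<close>

lemma reval_rf_mc:
  "reval rf_mc [enc_n \<phi>, enc_cpds H] (enc_mc (SNeg (input_sentence \<phi> (enc_n \<phi>) (enc_cpds H)), H))"
  unfolding rf_mc_def enc_mc_def fst_conv snd_conv enc_sent.simps
  by (intro reval_pair_of reval_rf_const reval_rf_sentence reval_Pj1)

text \<open>\<open>Q\<close> lies anywhere between the bounded nested words without collapse and all
  nested words, which treats \<open>SAT\<close> and \<open>SAT_bounded\<close> together.\<close>

lemma sat_undecidable:
  assumes "\<And>N. Q N \<Longrightarrow> is_2nw N" "\<And>N. is_2nw_nocollapse_bounded 2 N \<Longrightarrow> Q N"
  shows "\<not> decidable_on UNIV enc_sent (\<lambda>\<phi>. \<exists>N. Q N \<and> models N \<phi>)"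
proof (rule undecidable_by_diagonalization[where W = rf_sentence])
  fix g
  obtain R \<phi> where sim:
    "\<And>x y N. is_2nw N \<Longrightarrow> models N (input_sentence \<phi> x y) \<Longrightarrow> \<exists>v. reval g [x, y] v"
    "\<And>x y v. reval g [x, y] v \<Longrightarrow> \<exists>N\<in>lang (grid_cpds R). models N (input_sentence \<phi> x y)"
    using recf_simulation[of g] by blast
  have Q: "Q N" if "N \<in> lang (grid_cpds R)" for N
    using that assms(2) lang_bounded cpds_nocollapse_grid_cpds cpds_height_bounded_grid_cpds by blast
  let ?x = "enc_n \<phi>" and ?X = "input_sentence \<phi> (enc_n \<phi>) 0"
  have "reval rf_sentence [?x, 0] (enc_sent ?X)" by (rule reval_rf_sentence)
  moreover have "\<exists>N. Q N \<and> models N ?X" if "reval g [?x, 0] 0"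
    using sim(2)[OF that] Q by blast
  moreover have "\<exists>v. reval g [?x, 0] v" if "\<exists>N. Q N \<and> models N ?X"
    using that sim(1) assms(1) by blast
  ultimately show "\<exists>x y X. X \<in> UNIV \<and> reval rf_sentence [x, y] (enc_sent X) \<and>
      (reval g [x, y] 0 \<longrightarrow> (\<exists>N. Q N \<and> models N X)) \<and>
      ((\<exists>N. Q N \<and> models N X) \<longrightarrow> (\<exists>v. reval g [x, y] v))"
    by blast
qed

text \<open>A negated simulation sentence fails on the language exactly if some word satisfies the
  simulation, so diagonalization applies to the complement of \<open>MC\<close>. Every instance
  constructed has a grid automaton, so \<open>D\<close> may be any class that contains
  these.\<close>

lemma mc_undecidable:
  assumes "\<And>\<phi> R. (\<phi>, grid_cpds R) \<in> D"
  shows "\<not> decidable_on D enc_mc MC"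
proof
  assume "decidable_on D enc_mc MC"
  then have "decidable_on D enc_mc (\<lambda>x. \<not> MC x)" by (rule decidable_on_not)
  moreover have "\<not> decidable_on D enc_mc (\<lambda>x. \<not> MC x)"
  proof (rule undecidable_by_diagonalization[where W = rf_mc])
    fix g
    obtain R \<phi> where sim:
      "\<And>x y N. is_2nw N \<Longrightarrow> models N (input_sentence \<phi> x y) \<Longrightarrow> \<exists>v. reval g [x, y] v"
      "\<And>x y v. reval g [x, y] v \<Longrightarrow> \<exists>N\<in>lang (grid_cpds R). models N (input_sentence \<phi> x y)"
      using recf_simulation[of g] by blast
    have nw: "is_2nw N" if "N \<in> lang (grid_cpds R)" for N
      using that is_2nw_if_bounded lang_bounded cpds_nocollapse_grid_cpds cpds_height_bounded_grid_cpds
      by blast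
    let ?x = "enc_n \<phi>" and ?y = "enc_cpds (grid_cpds R)"
    let ?X = "(SNeg (input_sentence \<phi> ?x ?y), grid_cpds R)"
    have MC: "\<not> MC ?X \<longleftrightarrow> (\<exists>N\<in>lang (grid_cpds R). models N (input_sentence \<phi> ?x ?y))"
      by (auto simp: MC_def)
    have "?X \<in> D" by (rule assms)
    moreover have "reval rf_mc [?x, ?y] (enc_mc ?X)" by (rule reval_rf_mc)
    moreover have "\<not> MC ?X" if "reval g [?x, ?y] 0"
      unfolding MC by (rule sim(2)[OF that])
    moreover have "\<exists>v. reval g [?x, ?y] v" if "\<not> MC ?X"
      using that sim(1) nw unfolding MC by blast
    ultimately show "\<exists>x y X. X \<in> D \<and> reval rf_mc [x, y] (enc_mc X) \<and>
        (reval g [x, y] 0 \<longrightarrow> \<not> MC X) \<and> (\<not> MC X \<longrightarrow> (\<exists>v. reval g [x, y] v))"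
      by blast
  qed
  ultimately show False by blast
qed

theorem theorem3:
  shows "\<not> decidable_on UNIV enc_sent SAT
       \<and> \<not> decidable_on UNIV enc_mc MC
       \<and> (\<exists>k. \<not> decidable_on UNIV enc_sent (SAT_bounded k)
              \<and> \<not> decidable_on {x. cpds_nocollapse (snd x) \<and> cpds_height_bounded k (snd x)} enc_mc MC)"
proof (intro conjI exI[of _ 2])
  show "\<not> decidable_on UNIV enc_sent SAT"
    using sat_undecidable[of is_2nw] is_2nw_if_bounded unfolding SAT_def[abs_def] by blast
  show "\<not> decidable_on UNIV enc_sent (SAT_bounded 2)"
    using sat_undecidable[of "is_2nw_nocollapse_bounded 2"] is_2nw_if_bounded
    unfolding SAT_bounded_def[abs_def] by blast
  show "\<not> decidable_on UNIV enc_mc MC"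
    by (rule mc_undecidable) simp
  show "\<not> decidable_on {x. cpds_nocollapse (snd x) \<and> cpds_height_bounded 2 (snd x)} enc_mc MC"
    by (rule mc_undecidable) (simp add: cpds_nocollapse_grid_cpds cpds_height_bounded_grid_cpds)
qed

end
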